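(* Let $\alpha=(\{D_g\}_{g\in G},\{\alpha_g\}_{g\in G})$ be a partial action of a groupoid $G$ on a ring $R$, and suppose that $D_e$ is a unital ring for each $e\in G_0$. Then $\alpha$ admits a globalization $\beta$ if and only if each ideal $D_g$, $g\in G$, is a unital ring. Furthermore, if a globalization $\beta$ exists then it is unique up to equivalence.
   Context: Rings are associative, not necessarily commutative and not necessarily unital; ideals are two-sided; the zero ring counts as unital (with identity $0$). A groupoid is a non-empty set $G$ with a partially defined associative multiplication and inverses (a small category in which every morphism is invertible). For $g\in G$ put $d(g)=g^{-1}g$ and $r(g)=gg^{-1}$; the product $gh$ exists iff $d(g)=r(h)$, and $G^2=\{(g,h)\in G\times G: d(g)=r(h)\}$. $G_0$ is the set of identities $\{d(g):g\in G\}$. A partial action of $G$ on a ring $R$ is a pair $\alpha=(\{D_g\}_{g\in G},\{\alpha_g\}_{g\in G})$ where, for each $g\in G$, $D_{r(g)}$ is an ideal of $R$, $D_g$ is an ideal of $D_{r(g)}$, and $\alpha_g:D_{g^{-1}}\to D_g$ is a ring isomorphism, such that: (i) $\alpha_e=\mathrm{id}_{D_e}$ for all $e\in G_0$; (ii) $\alpha_h^{-1}(D_{g^{-1}}\cap D_h)\subseteq D_{(gh)^{-1}}$ for all $(g,h)\in G^2$; (iii) $\alpha_g(\alpha_h(x))=\alpha_{gh}(x)$ for all $(g,h)\in G^2$ and $x\in\alpha_h^{-1}(D_{g^{-1}}\cap D_h)$. The composition $\alpha_g\alpha_h$ is taken on its largest possible domain $\alpha_h^{-1}(D_{g^{-1}}\cap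 D_h)$. The partial action is global if $\alpha_g\alpha_h=\alpha_{gh}$ (as maps with domain) for all $(g,h)\in G^2$. A globalization of a partial action $\alpha$ of $G$ on $R$ is a global action $\beta=(\{E_g\}_{g\in G},\{\beta_g\}_{g\in G})$ of $G$ on some ring $T$ such that for each $e\in G_0$ there is an injective ring homomorphism (not required to preserve identities) $\varphi_e:D_e\to E_e$ with: (i) $\varphi_e(D_e)$ is an ideal of $E_e$ for all $e\in G_0$; (ii) $\varphi_{r(g)}(D_g)=\varphi_{r(g)}(D_{r(g)})\cap\beta_g(\varphi_{d(g)}(D_{d(g)}))$ for all $g\in G$; (iii) $\beta_g(\varphi_{d(g)}(a))=\varphi_{r(g)}(\alpha_g(a))$ for all $g\in G$ and $a\in D_{g^{-1}}$; (iv) $E_g=\sum_{r(h)=r(g)}\beta_h(\varphi_{d(h)}(D_{d(h)}))$ for all $g\in G$. The globalization $\beta$ is unique up to equivalence if for any global action $\beta'=(\{E'_g\}_{g\in G},\{\beta'_g\}_{g\in G})$ of $G$ on a ring $T'$ that is also a globalization of $\alpha$, there is for each $e\in G_0$ a ring isomorphism $\psi_e:E'_e\to E_e$ such that $\beta_g(\psi_{d(g)}(a))=\psi_{r(g)}(\beta'_g(a))$ for all $g\in G$ and $a\in E'_{d(g)}$. *)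

theory Defs
  imports "HOL-Library.Function_Algebras"
begin

text \<open>
  The class \<^class>\<open>ring\<close> does not ask for an identity or for commutativity. A ring is
  a subset of a type of this class that is closed under the operations; a whole type is the case
  where the subset is \<^term>\<open>UNIV\<close>. Maps between such rings are total functions whose
  values outside the domain are irrelevant.
\<close>

definition subrng :: "'a::ring set \<Rightarrow> bool" where
  "subrng S \<longleftrightarrow> 0 \<in> S \<and> (\<forall>x\<in>S. \<forall>y\<in>S. x - y \<in> S \<and> x * y \<in> S)"

definition ideal_of :: "'a::ring set \<Rightarrow> 'a set \<Rightarrow> bool" where
  "ideal_of I S \<longleftrightarrow> I \<subseteq> S \<and> 0 \<in> I \<and> (\<forall>x\<in>I. \<forall>y\<in>I. x - y \<in> I) \<and>
     (\<forall>x\<in>I. \<forall>s\<in>S. s * x \<in> I \<and> x * s \<in> I)"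

definition unital :: "'a::ring set \<Rightarrow> bool" where
  "unital S \<longleftrightarrow> (\<exists>u\<in>S. \<forall>x\<in>S. u * x = x \<and> x * u = x)"

definition rng_hom :: "'a::ring set \<Rightarrow> 'b::ring set \<Rightarrow> ('a \<Rightarrow> 'b) \<Rightarrow> bool" where
  "rng_hom A B f \<longleftrightarrow> f ` A \<subseteq> B \<and>
     (\<forall>x\<in>A. \<forall>y\<in>A. f (x + y) = f x + f y \<and> f (x * y) = f x * f y)"

definition rng_iso :: "'a::ring set \<Rightarrow> 'b::ring set \<Rightarrow> ('a \<Rightarrow> 'b) \<Rightarrow> bool" where
  "rng_iso A B f \<longleftrightarrow> rng_hom A B f \<and> bij_betw f A B"

text \<open>The sum of a possibly infinite family of additive subgroups.\<close>

definition family_sum :: "'i set \<Rightarrow> ('i \<Rightarrow> 'a::ring set) \<Rightarrow> 'a set" where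
  "family_sum I A = {sum x F | x F. finite F \<and> F \<subseteq> I \<and> (\<forall>i\<in>F. x i \<in> A i)}"

text \<open>
  The partial multiplication is a total function \<open>mul\<close>; the product of \<open>g\<close> and \<open>h\<close> counts as
  existing exactly when \<open>src G g = tgt G h\<close>, and other values of \<open>mul\<close> are never used. The maps
  written \<open>d\<close> and \<open>r\<close> in the literature are \<open>src\<close> and \<open>tgt\<close>.
\<close>

record 'g pregroupoid =
  arrows :: "'g set"
  mul :: "'g \<Rightarrow> 'g \<Rightarrow> 'g"  (infixl \<open>\<cdot>\<index>\<close> 70)
  ginv :: "'g \<Rightarrow> 'g"

definition src :: "('g, 'm) pregroupoid_scheme \<Rightarrow> 'g \<Rightarrow> 'g" where
  "src G g = ginv G g \<cdot>\<^bsub>G\<^esub> g"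

definition tgt :: "('g, 'm) pregroupoid_scheme \<Rightarrow> 'g \<Rightarrow> 'g" where
  "tgt G g = g \<cdot>\<^bsub>G\<^esub> ginv G g"

definition identities :: "('g, 'm) pregroupoid_scheme \<Rightarrow> 'g set" where
  "identities G = src G ` arrows G"

definition composable :: "('g, 'm) pregroupoid_scheme \<Rightarrow> ('g \<times> 'g) set" where
  "composable G = {(g, h). g \<in> arrows G \<and> h \<in> arrows G \<and> src G g = tgt G h}"

locale groupoid =
  fixes G :: "('g, 'm) pregroupoid_scheme" (structure)
  assumes nonempty: "arrows G \<noteq> {}"
    and inv_closed: "g \<in> arrows G \<Longrightarrow> ginv G g \<in> arrows G"
    and src_inv: "g \<in> arrows G \<Longrightarrow> src G (ginv G g) = tgt G g"
    and tgt_inv: "g \<in> arrows G \<Longrightarrow> tgt G (ginv G g) = src G g"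
    and mul_closed: "(g, h) \<in> composable G \<Longrightarrow> g \<cdot> h \<in> arrows G"
    and src_mul: "(g, h) \<in> composable G \<Longrightarrow> src G (g \<cdot> h) = src G h"
    and tgt_mul: "(g, h) \<in> composable G \<Longrightarrow> tgt G (g \<cdot> h) = tgt G g"
    and assoc: "(g, h) \<in> composable G \<Longrightarrow> (h, k) \<in> composable G \<Longrightarrow>
                  (g \<cdot> h) \<cdot> k = g \<cdot> (h \<cdot> k)"
    and mul_src: "g \<in> arrows G \<Longrightarrow> g \<cdot> src G g = g"
    and tgt_mul_self: "g \<in> arrows G \<Longrightarrow> tgt G g \<cdot> g = g"

text \<open>
  The largest domain of \<open>\<alpha> g \<circ> \<alpha> h\<close>, that is, the preimage of \<open>D (ginv G g) \<inter> D h\<close> under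
  \<open>\<alpha> h\<close>, whose domain is \<open>D (ginv G h)\<close>.
\<close>

definition comp_dom ::
  "('g, 'm) pregroupoid_scheme \<Rightarrow> ('g \<Rightarrow> 'a set) \<Rightarrow> ('g \<Rightarrow> 'a \<Rightarrow> 'a) \<Rightarrow> 'g \<Rightarrow> 'g \<Rightarrow> 'a set" where
  "comp_dom G D \<alpha> g h = {x \<in> D (ginv G h). \<alpha> h x \<in> D (ginv G g) \<inter> D h}"

locale partial_action = groupoid G
  for G :: "('g, 'm) pregroupoid_scheme" (structure) +
  fixes R :: "'a::ring set" and D :: "'g \<Rightarrow> 'a set" and \<alpha> :: "'g \<Rightarrow> 'a \<Rightarrow> 'a"
  assumes subrng_R: "subrng R"
    and ideal_tgt: "g \<in> arrows G \<Longrightarrow> ideal_of (D (tgt G g)) R"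
    and ideal_D: "g \<in> arrows G \<Longrightarrow> ideal_of (D g) (D (tgt G g))"
    and iso: "g \<in> arrows G \<Longrightarrow> rng_iso (D (ginv G g)) (D g) (\<alpha> g)"
    and act_id: "e \<in> identities G \<Longrightarrow> x \<in> D e \<Longrightarrow> \<alpha> e x = x"
    and comp_dom_subset: "(g, h) \<in> composable G \<Longrightarrow> comp_dom G D \<alpha> g h \<subseteq> D (ginv G (g \<cdot> h))"
    and act_mul: "(g, h) \<in> composable G \<Longrightarrow> x \<in> comp_dom G D \<alpha> g h \<Longrightarrow>
                    \<alpha> g (\<alpha> h x) = \<alpha> (g \<cdot> h) x"

text \<open>Equality of the partial maps \<open>\<alpha> g \<circ> \<alpha> h\<close> and \<open>\<alpha> (g \<cdot> h)\<close> includes equality of domains.\<close>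

locale global_action = partial_action G R D \<alpha>
  for G :: "('g, 'm) pregroupoid_scheme" (structure)
    and R :: "'a::ring set" and D :: "'g \<Rightarrow> 'a set" and \<alpha> :: "'g \<Rightarrow> 'a \<Rightarrow> 'a" +
  assumes global_dom: "(g, h) \<in> composable G \<Longrightarrow> comp_dom G D \<alpha> g h = D (ginv G (g \<cdot> h))"
    and global_mul: "(g, h) \<in> composable G \<Longrightarrow> x \<in> D (ginv G (g \<cdot> h)) \<Longrightarrow>
                       \<alpha> g (\<alpha> h x) = \<alpha> (g \<cdot> h) x"

text \<open>
  The type \<open>'t\<close> of the enveloping ring is independent of the type of the original ring. As
  HOL does not quantify over types, existence has to be stated at a particular type. The type of
  functions from arrows to the original ring, with the pointwise operations of
  \<^theory>\<open>HOL-Library.Function_Algebras\<close>, is large enough for the usual construction.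
\<close>

definition globalization ::
  "('g, 'm) pregroupoid_scheme \<Rightarrow> ('g \<Rightarrow> 'a::ring set) \<Rightarrow> ('g \<Rightarrow> 'a \<Rightarrow> 'a) \<Rightarrow>
   't::ring set \<Rightarrow> ('g \<Rightarrow> 't set) \<Rightarrow> ('g \<Rightarrow> 't \<Rightarrow> 't) \<Rightarrow> bool" where
  "globalization G D \<alpha> T E \<beta> \<longleftrightarrow> global_action G T E \<beta> \<and>
     (\<exists>\<phi> :: 'g \<Rightarrow> 'a \<Rightarrow> 't.
        (\<forall>e\<in>identities G. rng_hom (D e) (E e) (\<phi> e) \<and> inj_on (\<phi> e) (D e)) \<and>
        (\<forall>e\<in>identities G. ideal_of (\<phi> e ` D e) (E e)) \<and>
        (\<forall>g\<in>arrows G. \<phi> (tgt G g) ` D g =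
           \<phi> (tgt G g) ` D (tgt G g) \<inter> \<beta> g ` \<phi> (src G g) ` D (src G g)) \<and>
        (\<forall>g\<in>arrows G. \<forall>a\<in>D (ginv G g). \<beta> g (\<phi> (src G g) a) = \<phi> (tgt G g) (\<alpha> g a)) \<and>
        (\<forall>g\<in>arrows G. E g = family_sum {h \<in> arrows G. tgt G h = tgt G g}
           (\<lambda>h. \<beta> h ` \<phi> (src G h) ` D (src G h))))"

definition equivalent_actions ::
  "('g, 'm) pregroupoid_scheme \<Rightarrow> ('g \<Rightarrow> 't::ring set) \<Rightarrow> ('g \<Rightarrow> 't \<Rightarrow> 't) \<Rightarrow>
   ('g \<Rightarrow> 'u::ring set) \<Rightarrow> ('g \<Rightarrow> 'u \<Rightarrow> 'u) \<Rightarrow> bool" where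
  "equivalent_actions G E \<beta> E' \<beta>' \<longleftrightarrow>
     (\<exists>\<psi> :: 'g \<Rightarrow> 'u \<Rightarrow> 't.
        (\<forall>e\<in>identities G. rng_iso (E' e) (E e) (\<psi> e)) \<and>
        (\<forall>g\<in>arrows G. \<forall>a\<in>E' (src G g). \<beta> g (\<psi> (src G g) a) = \<psi> (tgt G g) (\<beta>' g a)))"

end

theory Submission
  imports Defs
begin

text \<open>
  \<^emph>\<open>A globalization forces identities.\<close> In a globalization, \<open>D g\<close> is embedded as the
  intersection of a copy of \<open>D (tgt G g)\<close> with a translate of \<open>D (src G g)\<close>. Both are unital
  ideals of the same ring, and the product of their identities is an identity of the intersection
  (\<open>unital_Int\<close>, \<open>unital_D\<close>).

  \<^emph>\<open>Extended maps.\<close> Conversely, let every \<open>D g\<close> have an identity \<open>\<epsilon> g\<close>. The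
  identity of an ideal is central in the surrounding ring, so \<open>\<gamma> g a = \<alpha> g (a * \<epsilon> (ginv G g))\<close> extends \<open>\<alpha> g\<close> to a ring homomorphism on all
  of \<open>D (src G g)\<close>. These maps are total, and they compose up to an idempotent:
  \<open>\<gamma> g (\<gamma> h a) = \<gamma> (g \<cdot> h) a * \<epsilon> g\<close> (\<open>\<gamma>_\<gamma>\<close>). The action on orbits below is built on this law.

  \<^emph>\<open>Construction.\<close> Send \<open>a \<in> D (src G h)\<close> to the function
  \<open>orbit h a = (\<lambda>k. \<gamma> (ginv G k \<cdot> h) a)\<close> on the arrows \<open>k\<close> with the same target as \<open>h\<close>. The
  composition law shows that products of orbits are orbits (\<open>orbit_mult_left\<close>,
  \<open>orbit_mult_right\<close>), so finite sums of orbits with a common target form a ring, and the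
  groupoid permutes these rings by translating the argument. This action is a globalization, with
  \<open>a \<mapsto> orbit e a\<close> as embedding of \<open>D e\<close> (\<open>env_globalization\<close>).

  \<^emph>\<open>Uniqueness.\<close> Any globalization \<open>\<beta>\<close> on rings \<open>E e\<close> is isomorphic to this one. Move
  \<open>x \<in> E e\<close> by \<open>\<beta> (ginv G k)\<close> and project onto \<open>D (src G k)\<close> by means of its identity; as \<open>k\<close>
  varies, the results form a function, the trace of \<open>x\<close>. The trace is an equivariant homomorphism
  and maps each translate of \<open>a\<close> to its orbit (\<open>proj_translate\<close>), so its image is the ring of sums
  of orbits. It is injective, since an element of trace zero annihilates a family of unital ideals
  whose sum is \<open>E e\<close>, and such sums have local units (\<open>family_sum_annihilator\<close>). Two
  globalizations are therefore equivalent through the action on orbits.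
\<close>

section \<open>Ideals, identities and sums of families\<close>

lemma subrng_add: "subrng S \<Longrightarrow> x \<in> S \<Longrightarrow> y \<in> S \<Longrightarrow> x + y \<in> S"
  unfolding subrng_def by (metis diff_0 diff_minus_eq_add)

lemma subrng_zero: "subrng S \<Longrightarrow> 0 \<in> S"
  and subrng_diff: "subrng S \<Longrightarrow> x \<in> S \<Longrightarrow> y \<in> S \<Longrightarrow> x - y \<in> S"
  and subrng_mult: "subrng S \<Longrightarrow> x \<in> S \<Longrightarrow> y \<in> S \<Longrightarrow> x * y \<in> S"
  unfolding subrng_def by auto

lemma ideal_subset: "ideal_of I S \<Longrightarrow> x \<in> I \<Longrightarrow> x \<in> S"
  and ideal_mult_left: "ideal_of I S \<Longrightarrow> s \<in> S \<Longrightarrow> x \<in> I \<Longrightarrow> s * x \<in> I"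
  and ideal_mult_right: "ideal_of I S \<Longrightarrow> x \<in> I \<Longrightarrow> s \<in> S \<Longrightarrow> x * s \<in> I"
  unfolding ideal_of_def by auto

lemma ideal_imp_subrng: "ideal_of I S \<Longrightarrow> subrng I"
  unfolding ideal_of_def subrng_def by blast

lemma rng_hom_zero: "rng_hom A B f \<Longrightarrow> subrng A \<Longrightarrow> f 0 = 0"
  unfolding rng_hom_def by (metis add_cancel_left_left subrng_zero)

lemma rng_hom_add: "rng_hom A B f \<Longrightarrow> x \<in> A \<Longrightarrow> y \<in> A \<Longrightarrow> f (x + y) = f x + f y"
  and rng_hom_mult: "rng_hom A B f \<Longrightarrow> x \<in> A \<Longrightarrow> y \<in> A \<Longrightarrow> f (x * y) = f x * f y"
  and rng_hom_in: "rng_hom A B f \<Longrightarrow> x \<in> A \<Longrightarrow> f x \<in> B"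
  unfolding rng_hom_def by auto

lemma rng_hom_diff:
  assumes "rng_hom A B f" "subrng A" "x \<in> A" "y \<in> A"
  shows "f (x - y) = f x - f y"
proof -
  have "f (x - y + y) = f (x - y) + f y"
    using assms by (intro rng_hom_add) (auto intro: subrng_diff)
  then show ?thesis by (simp add: eq_diff_eq)
qed

lemma ideal_of_image:
  assumes f: "rng_hom A B f" and onto: "f ` A = B" and A: "subrng A" and I: "ideal_of I A"
  shows "ideal_of (f ` I) B"
  unfolding ideal_of_def
proof (intro conjI ballI)
  have IA: "x \<in> A" if "x \<in> I" for x using ideal_subset[OF I that] .
  have sI: "subrng I" using I by (rule ideal_imp_subrng)
  show "f ` I \<subseteq> B" using IA rng_hom_in[OF f] by blast
  show "0 \<in> f ` I" using rng_hom_zero[OF f A] subrng_zero[OF sI] by (metis image_eqI)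
  fix x assume "x \<in> f ` I"
  then obtain x' where x': "x' \<in> I" "x = f x'" by auto
  { fix y assume "y \<in> f ` I"
    then obtain y' where "y' \<in> I" "y = f y'" by auto
    then show "x - y \<in> f ` I"
      using x' rng_hom_diff[OF f A] IA subrng_diff[OF sI] by (metis image_eqI) }
  fix s assume "s \<in> B"
  then obtain s' where s': "s' \<in> A" "s = f s'" using onto by auto
  show "s * x \<in> f ` I" "x * s \<in> f ` I"
    using x' s' IA rng_hom_mult[OF f] ideal_mult_left[OF I] ideal_mult_right[OF I]
    by (metis image_eqI)+
qed

lemma unital_image:
  assumes "rng_hom A B f" "S \<subseteq> A" "unital S"
  shows "unital (f ` S)"
proof -
  obtain u where u: "u \<in> S" "\<forall>x\<in>S. u * x = x \<and> x * u = x"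
    using assms(3) unfolding unital_def by auto
  have "f u * f x = f x \<and> f x * f u = f x" if "x \<in> S" for x
    using rng_hom_mult[OF assms(1)] u assms(2) that by (metis subsetD)
  then show ?thesis unfolding unital_def using u(1) by blast
qed

lemma unital_image_inj:
  assumes f: "rng_hom A B f" and "inj_on f A" and A: "subrng A" "subrng S" and S: "S \<subseteq> A"
    and "unital (f ` S)"
  shows "unital S"
proof -
  obtain u where u: "u \<in> S" "\<forall>x\<in>S. f u * f x = f x \<and> f x * f u = f x"
    using assms(6) unfolding unital_def by auto
  have "u * x = x \<and> x * u = x" if x: "x \<in> S" for x
    using u x S rng_hom_mult[OF f, symmetric] subrng_mult[OF A(2)]
      inj_onD[OF assms(2), of "u * x" x] inj_onD[OF assms(2), of "x * u" x] by (metis subsetD)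
  then show ?thesis unfolding unital_def using u(1) by blast
qed

text \<open>The product of the two identities is an identity of the intersection.\<close>

lemma unital_Int:
  assumes I: "ideal_of I S" "unital I" and J: "ideal_of J S" "unital J"
  shows "unital (I \<inter> J)"
proof -
  obtain u where u: "u \<in> I" "\<forall>x\<in>I. u * x = x \<and> x * u = x"
    using I(2) unfolding unital_def by auto
  obtain v where v: "v \<in> J" "\<forall>x\<in>J. v * x = x \<and> x * v = x"
    using J(2) unfolding unital_def by auto
  have "u * v \<in> I \<inter> J"
    using u v I J by (auto intro: ideal_mult_right ideal_mult_left ideal_subset)
  moreover have "u * v * x = x \<and> x * (u * v) = x" if "x \<in> I \<inter> J" for x
    using u v that by (simp add: mult.assoc) (simp flip: mult.assoc)
  ultimately show ?thesis unfolding unital_def by blast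
qed

definition rng_one :: "'a::ring set \<Rightarrow> 'a" where
  "rng_one S = (SOME u. u \<in> S \<and> (\<forall>x\<in>S. u * x = x \<and> x * u = x))"

lemma rng_one:
  assumes "unital S"
  shows rng_one_in: "rng_one S \<in> S"
    and rng_one_left: "x \<in> S \<Longrightarrow> rng_one S * x = x"
    and rng_one_right: "x \<in> S \<Longrightarrow> x * rng_one S = x"
proof -
  have "\<exists>u. u \<in> S \<and> (\<forall>x\<in>S. u * x = x \<and> x * u = x)"
    using assms unfolding unital_def by blast
  from someI_ex[OF this]
  show "rng_one S \<in> S" "x \<in> S \<Longrightarrow> rng_one S * x = x" "x \<in> S \<Longrightarrow> x * rng_one S = x"
    unfolding rng_one_def by blast+
qed

text \<open>Both products with \<open>s\<close> lie in the ideal, hence both equal \<open>u s u\<close> for the identity \<open>u\<close>.\<close>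

lemma rng_one_commute:
  assumes I: "ideal_of I S" "unital I" and s: "s \<in> S"
  shows "rng_one I * s = s * rng_one I"
proof -
  have "rng_one I * s = rng_one I * s * rng_one I"
    using rng_one_right[OF I(2)] ideal_mult_right[OF I(1) rng_one_in[OF I(2)] s] by simp
  also have "\<dots> = s * rng_one I"
    using rng_one_left[OF I(2)] ideal_mult_left[OF I(1) s rng_one_in[OF I(2)]]
    by (simp add: mult.assoc)
  finally show ?thesis .
qed

lemma family_sum_gen: "i \<in> I \<Longrightarrow> a \<in> A i \<Longrightarrow> a \<in> family_sum I A"
  unfolding family_sum_def by (rule CollectI, rule exI[of _ "\<lambda>_. a"], rule exI[of _ "{i}"]) auto

lemma family_sum_induct [consumes 1, case_names zero gen add]:
  assumes "x \<in> family_sum I A" and "P 0" and "\<And>i a. i \<in> I \<Longrightarrow> a \<in> A i \<Longrightarrow> P a"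
    and "\<And>x y. P x \<Longrightarrow> P y \<Longrightarrow> P (x + y)"
  shows "P x"
proof -
  obtain f F where F: "finite F" "F \<subseteq> I" "\<forall>i\<in>F. f i \<in> A i" and x: "x = sum f F"
    using assms(1) unfolding family_sum_def by auto
  from F have "P (sum f F)" by (induction F rule: finite_induct) (use assms in auto)
  then show ?thesis using x by simp
qed

lemma family_sum_zero: "0 \<in> family_sum I A"
  unfolding family_sum_def by (rule CollectI, rule exI, rule exI[of _ "{}"]) auto

lemma family_sum_cong: "(\<And>i. i \<in> I \<Longrightarrow> A i = B i) \<Longrightarrow> family_sum I A = family_sum I B"
  unfolding family_sum_def by (metis (no_types, lifting) subsetD)

lemma family_sum_add:
  assumes sub: "\<And>i. i \<in> I \<Longrightarrow> subrng (A i)"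
    and "x \<in> family_sum I A" "y \<in> family_sum I A"
  shows "x + y \<in> family_sum I A"
proof -
  obtain f F where F: "finite F" "F \<subseteq> I" "\<forall>i\<in>F. f i \<in> A i" and x: "x = sum f F"
    using assms(2) unfolding family_sum_def by auto
  obtain g H where H: "finite H" "H \<subseteq> I" "\<forall>i\<in>H. g i \<in> A i" and y: "y = sum g H"
    using assms(3) unfolding family_sum_def by auto
  define f' where "f' i = (if i \<in> F then f i else 0)" for i
  define g' where "g' i = (if i \<in> H then g i else 0)" for i
  have "x = sum f' (F \<union> H)" unfolding x f'_def using F(1) H(1)
    by (intro sum.mono_neutral_cong_left) auto
  moreover have "y = sum g' (F \<union> H)" unfolding y g'_def using F(1) H(1)
    by (intro sum.mono_neutral_cong_left) auto
  ultimately have "x + y = (\<Sum>i\<in>F \<union> H. f' i + g' i)" by (simp add: sum.distrib)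
  moreover have "f' i + g' i \<in> A i" if "i \<in> F \<union> H" for i
    using that F H sub unfolding f'_def g'_def by (intro subrng_add) (auto intro!: subrng_zero)
  ultimately show ?thesis
    unfolding family_sum_def using F H by (intro CollectI exI[of _ "\<lambda>i. f' i + g' i"]) auto
qed

lemma family_sum_uminus:
  assumes sub: "\<And>i. i \<in> I \<Longrightarrow> subrng (A i)" and "x \<in> family_sum I A"
  shows "- x \<in> family_sum I A"
  using assms(2)
proof (induction rule: family_sum_induct)
  case (gen i a)
  then have "- a \<in> A i" using sub by (metis diff_0 subrng_diff subrng_zero)
  then show ?case using gen by (intro family_sum_gen)
next
  case (add x y)
  then show ?case using family_sum_add[OF sub add.IH] by simp
qed (simp add: family_sum_zero)

text \<open>Distributivity reduces multiplicative closure to products of generators.\<close>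

lemma family_sum_subrng:
  assumes sub: "\<And>i. i \<in> I \<Longrightarrow> subrng (A i)"
    and prod: "\<And>i j a b. i \<in> I \<Longrightarrow> j \<in> I \<Longrightarrow> a \<in> A i \<Longrightarrow> b \<in> A j \<Longrightarrow> a * b \<in> family_sum I A"
  shows "subrng (family_sum I A)"
  unfolding subrng_def
proof (intro conjI ballI)
  fix x y assume x: "x \<in> family_sum I A" and y: "y \<in> family_sum I A"
  show "x - y \<in> family_sum I A"
    using family_sum_add[OF sub x family_sum_uminus[OF sub y]] by simp
  show "x * y \<in> family_sum I A" using x
  proof (induction rule: family_sum_induct)
    case zero then show ?case by (simp add: family_sum_zero)
  next
    case (add x x') then show ?case by (simp add: distrib_right family_sum_add[OF sub])
  next
    case (gen i a)
    show ?case using y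
      by (induction rule: family_sum_induct)
        (auto simp: family_sum_zero distrib_left intro: family_sum_add[OF sub] prod gen)
  qed
qed (rule family_sum_zero)

lemma family_sum_image:
  assumes f: "rng_hom S B f" and S: "subrng S" and A: "\<And>i. i \<in> I \<Longrightarrow> A i \<subseteq> S"
  shows "f ` family_sum I A = family_sum I (\<lambda>i. f ` A i)"
proof -
  have sum: "f (sum x F) = (\<Sum>i\<in>F. f (x i)) \<and> sum x F \<in> S"
    if "finite F" "F \<subseteq> I" "\<forall>i\<in>F. x i \<in> A i" for x F
    using that
  proof (induction F rule: finite_induct)
    case empty then show ?case using rng_hom_zero[OF f S] subrng_zero[OF S] by simp
  next
    case (insert i F)
    then have "x i \<in> S" using A by blast
    then show ?case using insert rng_hom_add[OF f] subrng_add[OF S] by simp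
  qed
  show ?thesis
  proof (intro set_eqI iffI)
    fix y assume "y \<in> f ` family_sum I A"
    then obtain x F where F: "finite F" "F \<subseteq> I" "\<forall>i\<in>F. x i \<in> A i" and "y = f (sum x F)"
      unfolding family_sum_def by auto
    then have "y = (\<Sum>i\<in>F. f (x i))" using sum by simp
    with F show "y \<in> family_sum I (\<lambda>i. f ` A i)"
      unfolding family_sum_def by (intro CollectI exI[of _ "\<lambda>i. f (x i)"] exI[of _ F]) auto
  next
    fix y assume "y \<in> family_sum I (\<lambda>i. f ` A i)"
    then obtain z F where F: "finite F" "F \<subseteq> I" "\<forall>i\<in>F. z i \<in> f ` A i" and y: "y = sum z F"
      unfolding family_sum_def by auto
    from F(3) obtain x where x: "\<forall>i\<in>F. x i \<in> A i \<and> z i = f (x i)"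
      unfolding image_iff by metis
    then have "y = f (sum x F)" using sum F y by simp
    moreover have "sum x F \<in> family_sum I A" unfolding family_sum_def using F x by auto
    ultimately show "y \<in> f ` family_sum I A" by blast
  qed
qed

text \<open>
  A sum of unital ideals has local units: if \<open>w\<close> is a right unit for some of the ideals and \<open>u\<close>
  is the identity of one more, then \<open>w + u - u w\<close> is a right unit for all of them. A member \<open>x\<close> of the
  sum is thus fixed by right multiplication with some \<open>w\<close>, and the same recursion keeps \<open>x w = 0\<close>.
\<close>

lemma family_sum_annihilator:
  assumes S: "subrng S" and A: "\<And>i. i \<in> I \<Longrightarrow> ideal_of (A i) S" "\<And>i. i \<in> I \<Longrightarrow> unital (A i)"
    and x: "x \<in> family_sum I A" and ann: "\<And>i a. i \<in> I \<Longrightarrow> a \<in> A i \<Longrightarrow> x * a = 0"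
  shows "x = 0"
proof -
  obtain f F where F: "finite F" "F \<subseteq> I" "\<forall>i\<in>F. f i \<in> A i" and xF: "x = sum f F"
    using x unfolding family_sum_def by auto
  have "\<exists>w\<in>S. (\<forall>i\<in>F. \<forall>a\<in>A i. a * w = a) \<and> x * w = 0" using F(1,2)
  proof (induction F rule: finite_induct)
    case empty
    show ?case using subrng_zero[OF S] by (intro bexI[of _ 0]) auto
  next
    case (insert j F)
    then obtain w where w: "w \<in> S" "\<forall>i\<in>F. \<forall>a\<in>A i. a * w = a" "x * w = 0" by auto
    have j: "j \<in> I" using insert by auto
    obtain u where u: "u \<in> A j" "\<forall>a\<in>A j. u * a = a \<and> a * u = a"
      using A(2)[OF j] unfolding unital_def by auto
    have uS: "u \<in> S" using ideal_subset[OF A(1)[OF j] u(1)] .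
    define v where "v = w + u - u * w"
    have "v \<in> S" unfolding v_def
      using S w(1) uS by (intro subrng_diff subrng_add subrng_mult)
    moreover have "a * v = a" if i: "i \<in> insert j F" and a: "a \<in> A i" for i a
    proof (cases "i = j")
      case True
      with a u show ?thesis unfolding v_def by (simp add: algebra_simps flip: mult.assoc)
    next
      case False
      with i have "i \<in> F" by auto
      moreover have "a * u \<in> A i"
        using ideal_mult_right[OF A(1) a uS] \<open>i \<in> F\<close> insert.prems by auto
      ultimately show ?thesis using w(2) a
        unfolding v_def by (simp add: algebra_simps flip: mult.assoc)
    qed
    moreover have "x * v = 0" using w(3) ann[OF j u(1)]
      unfolding v_def by (simp add: algebra_simps flip: mult.assoc)
    ultimately show ?case by blast
  qed
  then obtain w where w: "\<forall>i\<in>F. \<forall>a\<in>A i. a * w = a" "x * w = 0" by auto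
  have "x * w = x" unfolding xF sum_distrib_right using w(1) F(3) by (intro sum.cong) auto
  with w(2) show ?thesis by simp
qed


section \<open>Groupoids\<close>

context groupoid
begin

lemma composable_iff [simp]:
  "(g, h) \<in> composable G \<longleftrightarrow> g \<in> arrows G \<and> h \<in> arrows G \<and> src G g = tgt G h"
  unfolding composable_def by simp

declare inv_closed [simp] src_inv [simp] tgt_inv [simp] mul_closed [simp] src_mul [simp]
  tgt_mul [simp] mul_src [simp] tgt_mul_self [simp]

lemma src_closed [simp]: "g \<in> arrows G \<Longrightarrow> src G g \<in> arrows G"
  and tgt_closed [simp]: "g \<in> arrows G \<Longrightarrow> tgt G g \<in> arrows G"
  by (simp_all add: src_def[of G g] tgt_def[of G g])

lemma src_src [simp]: "g \<in> arrows G \<Longrightarrow> src G (src G g) = src G g"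
  and tgt_src [simp]: "g \<in> arrows G \<Longrightarrow> tgt G (src G g) = src G g"
  and src_tgt [simp]: "g \<in> arrows G \<Longrightarrow> src G (tgt G g) = tgt G g"
  and tgt_tgt [simp]: "g \<in> arrows G \<Longrightarrow> tgt G (tgt G g) = tgt G g"
proof -
  assume g: "g \<in> arrows G"
  have c: "(ginv G g, g) \<in> composable G" "(g, ginv G g) \<in> composable G" using g by simp_all
  show "src G (src G g) = src G g" "tgt G (src G g) = src G g"
    using src_mul[OF c(1)] tgt_mul[OF c(1)] g by (simp_all flip: src_def)
  show "src G (tgt G g) = tgt G g" "tgt G (tgt G g) = tgt G g"
    using src_mul[OF c(2)] tgt_mul[OF c(2)] g by (simp_all flip: tgt_def)
qed

lemma inv_cancel [simp]:
  "g \<in> arrows G \<Longrightarrow> h \<in> arrows G \<Longrightarrow> src G g = tgt G h \<Longrightarrow> ginv G g \<cdot> (g \<cdot> h) = h"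
  using assoc[of "ginv G g" g h] by (simp flip: src_def)

lemma cancel_inv [simp]:
  "g \<in> arrows G \<Longrightarrow> h \<in> arrows G \<Longrightarrow> tgt G g = tgt G h \<Longrightarrow> g \<cdot> (ginv G g \<cdot> h) = h"
  using assoc[of g "ginv G g" h] by (simp flip: tgt_def)

lemma inv_inv [simp]: "g \<in> arrows G \<Longrightarrow> ginv G (ginv G g) = g"
  using inv_cancel[of "ginv G g" g] mul_src[of "ginv G (ginv G g)"]
  by (simp add: src_def[of G g, symmetric])

lemma inv_mul [simp]:
  assumes "g \<in> arrows G" "h \<in> arrows G" "src G g = tgt G h"
  shows "ginv G (g \<cdot> h) = ginv G h \<cdot> ginv G g"
proof -
  have "(g \<cdot> h) \<cdot> (ginv G h \<cdot> ginv G g) = src G (ginv G (g \<cdot> h))"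
    using assms by (simp add: assoc) (simp flip: tgt_def)
  then have "ginv G (g \<cdot> h) \<cdot> ((g \<cdot> h) \<cdot> (ginv G h \<cdot> ginv G g)) = ginv G (g \<cdot> h)"
    using assms mul_src[of "ginv G (g \<cdot> h)"] by (simp del: src_inv)
  then show ?thesis
    using assms inv_cancel[of "g \<cdot> h" "ginv G h \<cdot> ginv G g"] by simp
qed

lemma identity_closed: "e \<in> identities G \<Longrightarrow> e \<in> arrows G"
  and src_identity: "e \<in> identities G \<Longrightarrow> src G e = e"
  and tgt_identity: "e \<in> identities G \<Longrightarrow> tgt G e = e"
  unfolding identities_def by auto

lemma inv_identity: "e \<in> identities G \<Longrightarrow> ginv G e = e"
  using mul_src[of "ginv G e"] src_def[of G e]
  by (metis identity_closed inv_closed src_identity src_inv tgt_identity)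

lemma src_in_identities [simp]: "g \<in> arrows G \<Longrightarrow> src G g \<in> identities G"
  unfolding identities_def by simp

lemma tgt_in_identities [simp]: "g \<in> arrows G \<Longrightarrow> tgt G g \<in> identities G"
  using src_in_identities[of "ginv G g"] by simp

lemma inv_src [simp]: "g \<in> arrows G \<Longrightarrow> ginv G (src G g) = src G g"
  and inv_tgt [simp]: "g \<in> arrows G \<Longrightarrow> ginv G (tgt G g) = tgt G g"
  by (simp_all add: inv_identity)

lemma mul_cancel [simp]:
  "g \<in> arrows G \<Longrightarrow> h \<in> arrows G \<Longrightarrow> src G g = tgt G h \<Longrightarrow> (g \<cdot> h) \<cdot> ginv G h = g"
  using assoc[of g h "ginv G h"] mul_src[of g] by (simp flip: tgt_def)

lemma quotient_mul [simp]:
  assumes "h \<in> arrows G" "k \<in> arrows G" "m \<in> arrows G" "tgt G h = tgt G k" "tgt G m = tgt G k"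
  shows "(ginv G m \<cdot> k) \<cdot> (ginv G k \<cdot> h) = ginv G m \<cdot> h"
  using assms by (simp add: assoc)

end


section \<open>Partial actions with unital domains\<close>

context partial_action
begin

lemma D_ideal: "g \<in> arrows G \<Longrightarrow> tgt G g = e \<Longrightarrow> ideal_of (D g) (D e)"
  using ideal_D by blast

lemma subrng_D: "g \<in> arrows G \<Longrightarrow> subrng (D g)"
  using ideal_D ideal_imp_subrng by blast

lemma D_subset: "g \<in> arrows G \<Longrightarrow> tgt G g = e \<Longrightarrow> x \<in> D g \<Longrightarrow> x \<in> D e"
  using D_ideal ideal_subset by blast

lemma \<alpha>_hom: "g \<in> arrows G \<Longrightarrow> rng_hom (D (ginv G g)) (D g) (\<alpha> g)"
  using iso unfolding rng_iso_def by blast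

lemma \<alpha>_in: "g \<in> arrows G \<Longrightarrow> x \<in> D (ginv G g) \<Longrightarrow> \<alpha> g x \<in> D g"
  using \<alpha>_hom rng_hom_in by blast

lemma \<alpha>_inv_left:
  assumes g: "g \<in> arrows G" and x: "x \<in> D (ginv G g)"
  shows "\<alpha> (ginv G g) (\<alpha> g x) = x"
proof -
  have "x \<in> comp_dom G D \<alpha> (ginv G g) g"
    unfolding comp_dom_def using g x \<alpha>_in by simp
  then have "\<alpha> (ginv G g) (\<alpha> g x) = \<alpha> (src G g) x"
    using act_mul[of "ginv G g" g x] g by (simp flip: src_def)
  also have "\<dots> = x" using act_id[of "src G g" x] g x D_subset[of "ginv G g"] by simp
  finally show ?thesis .
qed

lemma \<alpha>_inv_right: "g \<in> arrows G \<Longrightarrow> x \<in> D g \<Longrightarrow> \<alpha> g (\<alpha> (ginv G g) x) = x"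
  using \<alpha>_inv_left[of "ginv G g" x] by simp

lemma \<alpha>_compose:
  assumes "g \<in> arrows G" "h \<in> arrows G" "src G g = tgt G h"
    and "x \<in> D (ginv G h)" "\<alpha> h x \<in> D (ginv G g)"
  shows "x \<in> D (ginv G h \<cdot> ginv G g)" and "\<alpha> g (\<alpha> h x) = \<alpha> (g \<cdot> h) x"
proof -
  have x: "x \<in> comp_dom G D \<alpha> g h" unfolding comp_dom_def using assms \<alpha>_in by simp
  show "x \<in> D (ginv G h \<cdot> ginv G g)" using comp_dom_subset[of g h] x assms by auto
  show "\<alpha> g (\<alpha> h x) = \<alpha> (g \<cdot> h) x" using act_mul[of g h] x assms by auto
qed

text \<open>
  Writing \<open>x\<close> as \<open>\<alpha> h y\<close> turns \<open>\<alpha> g x\<close> into \<open>\<alpha> (g \<cdot> h) y\<close>.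
\<close>

lemma \<alpha>_transport:
  assumes "g \<in> arrows G" "h \<in> arrows G" "src G g = tgt G h" "x \<in> D (ginv G g)" "x \<in> D h"
  shows "\<alpha> g x \<in> D (g \<cdot> h)"
proof -
  have y: "\<alpha> (ginv G h) x \<in> D (ginv G h)" "\<alpha> h (\<alpha> (ginv G h) x) = x"
    using assms \<alpha>_in[of "ginv G h"] \<alpha>_inv_right by simp_all
  then have "\<alpha> g x = \<alpha> (g \<cdot> h) (\<alpha> (ginv G h) x)" "\<alpha> (ginv G h) x \<in> D (ginv G (g \<cdot> h))"
    using \<alpha>_compose[of g h "\<alpha> (ginv G h) x"] assms by simp_all
  then show ?thesis using \<alpha>_in assms by simp
qed

end

locale unital_partial_action = partial_action G R D \<alpha>
  for G :: "('g, 'm) pregroupoid_scheme" (structure)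
    and R :: "'a::ring set" and D :: "'g \<Rightarrow> 'a set" and \<alpha> :: "'g \<Rightarrow> 'a \<Rightarrow> 'a" +
  assumes unital_D: "g \<in> arrows G \<Longrightarrow> unital (D g)"
begin

abbreviation \<epsilon> :: "'g \<Rightarrow> 'a" where "\<epsilon> g \<equiv> rng_one (D g)"

lemma \<epsilon>_in: "g \<in> arrows G \<Longrightarrow> \<epsilon> g \<in> D g"
  and \<epsilon>_left: "g \<in> arrows G \<Longrightarrow> x \<in> D g \<Longrightarrow> \<epsilon> g * x = x"
  and \<epsilon>_right: "g \<in> arrows G \<Longrightarrow> x \<in> D g \<Longrightarrow> x * \<epsilon> g = x"
  using rng_one unital_D by blast+

lemma \<epsilon>_commute: "g \<in> arrows G \<Longrightarrow> tgt G g = e \<Longrightarrow> x \<in> D e \<Longrightarrow> \<epsilon> g * x = x * \<epsilon> g"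
  using rng_one_commute[OF D_ideal unital_D] by blast

lemma \<epsilon>_commute_\<epsilon>:
  "g \<in> arrows G \<Longrightarrow> h \<in> arrows G \<Longrightarrow> tgt G g = tgt G h \<Longrightarrow> \<epsilon> g * \<epsilon> h = \<epsilon> h * \<epsilon> g"
  using \<epsilon>_commute[of g "tgt G g" "\<epsilon> h"] \<epsilon>_in[of h] D_subset[of h] by simp

lemma \<epsilon>_mult:
  assumes "g \<in> arrows G" "h \<in> arrows G" "tgt G g = tgt G h"
  shows \<epsilon>_mult_in: "\<epsilon> g * \<epsilon> h \<in> D g" "\<epsilon> g * \<epsilon> h \<in> D h"
    and \<epsilon>_mult_left: "x \<in> D g \<Longrightarrow> x \<in> D h \<Longrightarrow> \<epsilon> g * \<epsilon> h * x = x"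
    and \<epsilon>_mult_right: "x \<in> D g \<Longrightarrow> x \<in> D h \<Longrightarrow> x * (\<epsilon> g * \<epsilon> h) = x"
proof -
  show "\<epsilon> g * \<epsilon> h \<in> D g"
    using assms \<epsilon>_in D_subset[of h] by (intro ideal_mult_right[OF D_ideal[of g]]) auto
  show "\<epsilon> g * \<epsilon> h \<in> D h"
    using assms \<epsilon>_in D_subset[of g] by (intro ideal_mult_left[OF D_ideal[of h]]) auto
  show "x \<in> D g \<Longrightarrow> x \<in> D h \<Longrightarrow> \<epsilon> g * \<epsilon> h * x = x"
    using assms \<epsilon>_left by (simp add: mult.assoc)
  show "x \<in> D g \<Longrightarrow> x \<in> D h \<Longrightarrow> x * (\<epsilon> g * \<epsilon> h) = x"
    using assms \<epsilon>_right by (simp flip: mult.assoc)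
qed

text \<open>
  By transport along \<open>g\<close> and back, \<open>\<alpha> g\<close> restricts to an isomorphism from \<open>D (ginv G g) \<inter> D h\<close> onto \<open>D g \<inter> D (g \<cdot> h)\<close>,
  so it matches the identities of these two ideals.
\<close>

lemma \<alpha>_\<epsilon>_mult:
  assumes gh: "g \<in> arrows G" "h \<in> arrows G" "src G g = tgt G h"
  shows "\<alpha> g (\<epsilon> (ginv G g) * \<epsilon> h) = \<epsilon> g * \<epsilon> (g \<cdot> h)"
proof -
  let ?f = "\<epsilon> (ginv G g) * \<epsilon> h" and ?v = "\<epsilon> g * \<epsilon> (g \<cdot> h)"
  have f: "?f \<in> D (ginv G g)" "?f \<in> D h" and v: "?v \<in> D g" "?v \<in> D (g \<cdot> h)"
    using \<epsilon>_mult_in gh by simp_all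
  define w where "w = \<alpha> (ginv G g) ?v"
  have w: "w \<in> D (ginv G g)" "w \<in> D h" and vw: "\<alpha> g w = ?v"
    using \<alpha>_in[of "ginv G g"] \<alpha>_transport[of "ginv G g" "g \<cdot> h" ?v] \<alpha>_inv_right v gh
    unfolding w_def by simp_all
  have "\<alpha> g ?f = \<alpha> g ?f * ?v"
    using \<epsilon>_mult_right[of g "g \<cdot> h" "\<alpha> g ?f"] \<alpha>_in \<alpha>_transport f gh by simp
  also have "\<dots> = \<alpha> g (?f * w)" using rng_hom_mult[OF \<alpha>_hom] f w vw gh by simp
  also have "?f * w = w" using \<epsilon>_mult_left[of "ginv G g" h w] w gh by simp
  finally show ?thesis using vw by simp
qed

text \<open>
  Cutting down by the identity of its domain extends \<open>\<alpha> g\<close> to a homomorphism that is defined on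
  all of \<open>D (src G g)\<close>. In a globalization this is translation by \<open>g\<close> followed by the projection
  onto \<open>D (tgt G g)\<close>.
\<close>

definition \<gamma> :: "'g \<Rightarrow> 'a \<Rightarrow> 'a" where
  "\<gamma> g a = \<alpha> g (a * \<epsilon> (ginv G g))"

lemma mult_\<epsilon>_inv_in: "g \<in> arrows G \<Longrightarrow> a \<in> D (src G g) \<Longrightarrow> a * \<epsilon> (ginv G g) \<in> D (ginv G g)"
  using \<epsilon>_in by (intro ideal_mult_left[OF D_ideal]) auto

lemma \<gamma>_in: "g \<in> arrows G \<Longrightarrow> a \<in> D (src G g) \<Longrightarrow> \<gamma> g a \<in> D g"
  unfolding \<gamma>_def by (intro \<alpha>_in mult_\<epsilon>_inv_in)

lemma \<gamma>_in_tgt: "g \<in> arrows G \<Longrightarrow> a \<in> D (src G g) \<Longrightarrow> tgt G g = e \<Longrightarrow> \<gamma> g a \<in> D e"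
  using \<gamma>_in D_subset by blast

lemma \<gamma>_hom: "g \<in> arrows G \<Longrightarrow> rng_hom (D (src G g)) (D g) (\<gamma> g)"
  unfolding rng_hom_def
proof (intro conjI ballI)
  assume g: "g \<in> arrows G"
  show "\<gamma> g ` D (src G g) \<subseteq> D g" using \<gamma>_in g by auto
  fix a b assume a: "a \<in> D (src G g)" and b: "b \<in> D (src G g)"
  let ?u = "\<epsilon> (ginv G g)"
  show "\<gamma> g (a + b) = \<gamma> g a + \<gamma> g b"
    unfolding \<gamma>_def using rng_hom_add[OF \<alpha>_hom] mult_\<epsilon>_inv_in a b g by (simp add: distrib_right)
  have "a * b * ?u = a * (b * ?u * ?u)"
    using \<epsilon>_right[of "ginv G g"] \<epsilon>_in[of "ginv G g"] g by (simp add: mult.assoc)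
  also have "b * ?u = ?u * b"
    using \<epsilon>_commute[of "ginv G g" "src G g" b] b g by simp
  also have "a * (?u * b * ?u) = (a * ?u) * (b * ?u)" by (simp add: mult.assoc)
  finally show "\<gamma> g (a * b) = \<gamma> g a * \<gamma> g b"
    unfolding \<gamma>_def using rng_hom_mult[OF \<alpha>_hom] mult_\<epsilon>_inv_in a b g by simp
qed

lemma \<gamma>_eq_\<alpha>: "g \<in> arrows G \<Longrightarrow> a \<in> D (ginv G g) \<Longrightarrow> \<gamma> g a = \<alpha> g a"
  unfolding \<gamma>_def using \<epsilon>_right[of "ginv G g"] by simp

lemma \<gamma>_identity: "e \<in> identities G \<Longrightarrow> a \<in> D e \<Longrightarrow> \<gamma> e a = a"
  using \<gamma>_eq_\<alpha>[of e a] act_id inv_identity identity_closed by simp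

text \<open>
  The extended maps compose up to an idempotent. With \<open>f\<close> the identity of
  \<open>D (ginv G h) \<inter> D (ginv G (g \<cdot> h))\<close>, both sides are the image of \<open>a f\<close>: the partial map
  \<open>\<alpha> g \<circ> \<alpha> h\<close> is defined at \<open>a f\<close> and agrees there with \<open>\<alpha> (g \<cdot> h)\<close>.
\<close>

lemma \<gamma>_\<gamma>:
  assumes gh: "g \<in> arrows G" "h \<in> arrows G" "src G g = tgt G h" and a: "a \<in> D (src G h)"
  shows "\<gamma> g (\<gamma> h a) = \<gamma> (g \<cdot> h) a * \<epsilon> g"
proof -
  define p where "p = g \<cdot> h"
  have p: "p \<in> arrows G" "src G p = src G h" "tgt G p = tgt G g" "ginv G p = ginv G h \<cdot> ginv G g"
    "h \<cdot> ginv G p = ginv G g" "p \<cdot> ginv G h = g"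
    unfolding p_def using gh by simp_all
  define f where "f = \<epsilon> (ginv G h) * \<epsilon> (ginv G p)"
  have f': "f = \<epsilon> (ginv G p) * \<epsilon> (ginv G h)"
    unfolding f_def using \<epsilon>_commute_\<epsilon> p gh by simp
  have fD: "f \<in> D (ginv G h)" "f \<in> D (ginv G p)"
    unfolding f_def using \<epsilon>_mult_in[of "ginv G h" "ginv G p"] p gh by (simp_all del: inv_mul)
  have idem: "\<epsilon> (ginv G h) * f = f" "\<epsilon> (ginv G p) * f = f"
    using \<epsilon>_left fD p(1) gh by simp_all
  have "\<alpha> h (a * f) = \<alpha> h ((a * \<epsilon> (ginv G h)) * f)"
    using idem by (simp add: mult.assoc)
  also have "\<dots> = \<gamma> h a * \<alpha> h f"
    using rng_hom_mult[OF \<alpha>_hom] mult_\<epsilon>_inv_in a fD gh unfolding \<gamma>_def by simp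
  also have "\<alpha> h f = \<epsilon> h * \<epsilon> (ginv G g)"
    unfolding f_def using \<alpha>_\<epsilon>_mult[of h "ginv G p"] p gh by (simp del: inv_mul)
  finally have 1: "\<alpha> h (a * f) = \<gamma> h a * \<epsilon> (ginv G g)"
    using \<epsilon>_right[of h "\<gamma> h a"] \<gamma>_in a gh by (simp add: mult.assoc[symmetric])
  have af: "a * f \<in> D (ginv G h)"
    using a fD gh by (intro ideal_mult_left[OF D_ideal]) auto
  have "\<alpha> h (a * f) \<in> D (ginv G g)"
    unfolding 1 using \<gamma>_in_tgt[of h a] a gh by (intro mult_\<epsilon>_inv_in) auto
  then have "\<gamma> g (\<gamma> h a) = \<alpha> p (a * f)"
    using \<alpha>_compose(2)[of g h "a * f"] af gh 1 unfolding \<gamma>_def p_def by simp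
  also have "\<dots> = \<alpha> p ((a * \<epsilon> (ginv G p)) * f)"
    using idem by (simp add: mult.assoc)
  also have "\<dots> = \<gamma> p a * \<alpha> p f"
    using rng_hom_mult[OF \<alpha>_hom[OF p(1)]] mult_\<epsilon>_inv_in[OF p(1)] a fD p(2) unfolding \<gamma>_def by simp
  also have "\<alpha> p f = \<epsilon> p * \<epsilon> g"
    unfolding f' using \<alpha>_\<epsilon>_mult[of p "ginv G h"] p gh by simp
  finally show ?thesis
    using \<epsilon>_right[of p "\<gamma> p a"] \<gamma>_in a p(1,2) unfolding p_def[symmetric]
    by (simp add: mult.assoc[symmetric])
qed

text \<open>
  On \<open>D (ginv G g)\<close> the correcting idempotent disappears: the composition law applied to
  \<open>k, g\<close> and to \<open>k \<cdot> g, ginv G g\<close> makes each side a multiple of the other by an idempotent.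
\<close>

lemma \<gamma>_\<alpha>:
  assumes gk: "g \<in> arrows G" "k \<in> arrows G" "src G k = tgt G g" and b: "b \<in> D (ginv G g)"
  shows "\<gamma> k (\<alpha> g b) = \<gamma> (k \<cdot> g) b"
proof -
  have b': "b \<in> D (src G g)" using b gk D_subset[of "ginv G g"] by simp
  have a: "\<alpha> g b \<in> D g" "\<alpha> g b \<in> D (tgt G g)" using \<alpha>_in D_subset b gk by auto
  define X Y where "X = \<gamma> k (\<alpha> g b)" and "Y = \<gamma> (k \<cdot> g) b"
  have X: "X = Y * \<epsilon> k"
    unfolding X_def Y_def using \<gamma>_\<gamma>[of k g b] \<gamma>_eq_\<alpha> gk b b' by simp
  have "b = \<gamma> (ginv G g) (\<alpha> g b)" using \<gamma>_eq_\<alpha>[of "ginv G g"] \<alpha>_inv_left gk a b by simp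
  then have Y: "Y = X * \<epsilon> (k \<cdot> g)"
    using \<gamma>_\<gamma>[of "k \<cdot> g" "ginv G g" "\<alpha> g b"] gk a unfolding X_def Y_def by simp
  have "X * \<epsilon> k = X" unfolding X_def using \<epsilon>_right[of k] \<gamma>_in[of k] a gk by simp
  then have "Y * \<epsilon> k = Y"
    using Y \<epsilon>_commute_\<epsilon>[of "k \<cdot> g" k] gk by (metis mult.assoc mul_closed tgt_mul composable_iff)
  with X show ?thesis unfolding X_def Y_def by simp
qed


section \<open>The enveloping action\<close>

text \<open>
  The function \<open>orbit h a\<close> records all translates of \<open>a\<close>, cut down to the original ring: it is
  the trace that the element \<open>\<beta> h (\<phi> (src G h) a)\<close> of any globalization leaves there.
\<close>

definition orbit :: "'g \<Rightarrow> 'a \<Rightarrow> 'g \<Rightarrow> 'a" where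
  "orbit h a = (\<lambda>k. if k \<in> arrows G \<and> tgt G k = tgt G h then \<gamma> (ginv G k \<cdot> h) a else 0)"

definition env :: "'g \<Rightarrow> ('g \<Rightarrow> 'a) set" where
  "env g = family_sum {h \<in> arrows G. tgt G h = tgt G g} (\<lambda>h. orbit h ` D (src G h))"

definition shift :: "'g \<Rightarrow> ('g \<Rightarrow> 'a) \<Rightarrow> 'g \<Rightarrow> 'a" where
  "shift g f = (\<lambda>k. if k \<in> arrows G \<and> tgt G k = tgt G g then f (ginv G g \<cdot> k) else 0)"

text \<open>
  At an arrow \<open>m\<close>, the value of \<open>orbit k b\<close> absorbs the idempotent \<open>\<epsilon> (ginv G m \<cdot> k)\<close>, which is
  exactly the factor that separates \<open>\<gamma> (ginv G m \<cdot> h) a\<close> from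
  \<open>\<gamma> (ginv G m \<cdot> k) (\<gamma> (ginv G k \<cdot> h) a)\<close>. The mirror image holds by centrality of the idempotents.
\<close>

lemma orbit_mult_left:
  assumes hk: "h \<in> arrows G" "k \<in> arrows G" "tgt G h = tgt G k"
    and a: "a \<in> D (src G h)" and b: "b \<in> D (src G k)"
  shows "orbit h a * orbit k b = orbit k (\<gamma> (ginv G k \<cdot> h) a * b)"
proof
  fix m
  show "(orbit h a * orbit k b) m = orbit k (\<gamma> (ginv G k \<cdot> h) a * b) m"
  proof (cases "m \<in> arrows G \<and> tgt G m = tgt G k")
    case True
    let ?g = "ginv G m \<cdot> k" and ?l = "ginv G k \<cdot> h"
    have g: "?g \<in> arrows G" "src G ?g = src G k" "?l \<in> arrows G" "tgt G ?l = src G k"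
      "src G ?l = src G h" using True hk by simp_all
    have "\<gamma> ?g (\<gamma> ?l a * b) = \<gamma> ?g (\<gamma> ?l a) * \<gamma> ?g b"
      using rng_hom_mult[OF \<gamma>_hom] \<gamma>_in_tgt[of ?l a] a b g by simp
    also have "\<dots> = \<gamma> (?g \<cdot> ?l) a * (\<epsilon> ?g * \<gamma> ?g b)"
      using \<gamma>_\<gamma>[of ?g ?l a] a g by (simp add: mult.assoc)
    also have "\<dots> = \<gamma> (ginv G m \<cdot> h) a * \<gamma> ?g b"
      using \<epsilon>_left[of ?g] \<gamma>_in[of ?g b] b g True hk by simp
    finally show ?thesis using True hk by (simp add: orbit_def)
  qed (use hk in \<open>auto simp: orbit_def\<close>)
qed

lemma orbit_mult_right:
  assumes hk: "h \<in> arrows G" "k \<in> arrows G" "tgt G h = tgt G k"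
    and a: "a \<in> D (src G h)" and b: "b \<in> D (src G k)"
  shows "orbit h a * orbit k b = orbit h (a * \<gamma> (ginv G h \<cdot> k) b)"
proof
  fix m
  show "(orbit h a * orbit k b) m = orbit h (a * \<gamma> (ginv G h \<cdot> k) b) m"
  proof (cases "m \<in> arrows G \<and> tgt G m = tgt G h")
    case True
    let ?g = "ginv G m \<cdot> h" and ?l = "ginv G h \<cdot> k"
    have g: "?g \<in> arrows G" "src G ?g = src G h" "?l \<in> arrows G" "tgt G ?l = src G h"
      "src G ?l = src G k" using True hk by simp_all
    have gl: "?g \<cdot> ?l = ginv G m \<cdot> k" "ginv G m \<cdot> k \<in> arrows G" "src G (ginv G m \<cdot> k) = src G k"
      "tgt G (ginv G m \<cdot> k) = tgt G ?g" using True hk by simp_all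
    have "\<gamma> ?g (a * \<gamma> ?l b) = \<gamma> ?g a * \<gamma> ?g (\<gamma> ?l b)"
      using rng_hom_mult[OF \<gamma>_hom] \<gamma>_in_tgt[of ?l b] a b g by simp
    also have "\<dots> = \<gamma> ?g a * (\<gamma> (ginv G m \<cdot> k) b * \<epsilon> ?g)"
      using \<gamma>_\<gamma>[of ?g ?l b] b g gl by simp
    also have "\<gamma> (ginv G m \<cdot> k) b * \<epsilon> ?g = \<epsilon> ?g * \<gamma> (ginv G m \<cdot> k) b"
      using \<epsilon>_commute[of ?g "tgt G ?g"] \<gamma>_in_tgt[of "ginv G m \<cdot> k" b] b g gl by simp
    also have "\<gamma> ?g a * (\<epsilon> ?g * \<gamma> (ginv G m \<cdot> k) b) = \<gamma> ?g a * \<gamma> (ginv G m \<cdot> k) b"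
      using \<epsilon>_right[of ?g "\<gamma> ?g a"] \<gamma>_in[of ?g a] a g by (simp add: mult.assoc[symmetric])
    finally show ?thesis using True hk by (simp add: orbit_def)
  qed (use hk in \<open>auto simp: orbit_def\<close>)
qed

lemma orbit_hom: "h \<in> arrows G \<Longrightarrow> rng_hom (D (src G h)) UNIV (orbit h)"
  unfolding rng_hom_def
  by (auto simp: orbit_def fun_eq_iff rng_hom_add[OF \<gamma>_hom] rng_hom_mult[OF \<gamma>_hom])

lemma orbit_in_env:
  "h \<in> arrows G \<Longrightarrow> tgt G h = tgt G g \<Longrightarrow> a \<in> D (src G h) \<Longrightarrow> orbit h a \<in> env g"
  unfolding env_def by (intro family_sum_gen[of h]) auto

lemma env_induct [consumes 1, case_names zero gen add]:
  assumes "x \<in> env g" and "P 0"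
    and "\<And>h a. h \<in> arrows G \<Longrightarrow> tgt G h = tgt G g \<Longrightarrow> a \<in> D (src G h) \<Longrightarrow> P (orbit h a)"
    and "\<And>x y. P x \<Longrightarrow> P y \<Longrightarrow> P (x + y)"
  shows "P x"
  using assms(1) unfolding env_def
  by (induction rule: family_sum_induct) (use assms(2-4) in blast)+

lemma env_cong: "tgt G g = tgt G h \<Longrightarrow> env g = env h"
  unfolding env_def by simp

lemma subrng_orbits: "h \<in> arrows G \<Longrightarrow> subrng (orbit h ` D (src G h))"
  using ideal_imp_subrng[OF ideal_of_image[of "D (src G h)" "orbit h ` D (src G h)" "orbit h"]]
    orbit_hom[of h] D_ideal[of "src G h"] subrng_D[of "src G h"]
  unfolding rng_hom_def by simp

lemma subrng_env: "g \<in> arrows G \<Longrightarrow> subrng (env g)"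
  unfolding env_def
proof (rule family_sum_subrng; clarsimp?)
  show "h \<in> arrows G \<Longrightarrow> subrng (orbit h ` D (src G h))" for h by (rule subrng_orbits)
  fix h k a b
  assume *: "h \<in> arrows G" "k \<in> arrows G" "tgt G h = tgt G g" "tgt G k = tgt G g"
    "a \<in> D (src G h)" "b \<in> D (src G k)"
  then have "\<gamma> (ginv G k \<cdot> h) a * b \<in> D (src G k)"
    using \<gamma>_in_tgt[of "ginv G k \<cdot> h" a] subrng_D by (intro subrng_mult) auto
  then show "orbit h a * orbit k b
      \<in> family_sum {h \<in> arrows G. tgt G h = tgt G g} (\<lambda>h. orbit h ` D (src G h))"
    using * orbit_mult_left by (intro family_sum_gen[of k]) auto
qed

lemma env_support: "x \<in> env g \<Longrightarrow> \<not> (k \<in> arrows G \<and> tgt G k = tgt G g) \<Longrightarrow> x k = 0"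
  by (induction rule: env_induct) (auto simp: orbit_def)

lemma shift_orbit:
  "g \<in> arrows G \<Longrightarrow> h \<in> arrows G \<Longrightarrow> src G g = tgt G h \<Longrightarrow> shift g (orbit h a) = orbit (g \<cdot> h) a"
  by (auto simp: shift_def orbit_def fun_eq_iff assoc)

lemma shift_add: "shift g (x + y) = shift g x + shift g y"
  and shift_mult: "shift g (x * y) = shift g x * shift g y"
  and shift_zero: "shift g 0 = 0"
  by (auto simp: shift_def fun_eq_iff)

lemma shift_in_env:
  "x \<in> env h \<Longrightarrow> g \<in> arrows G \<Longrightarrow> src G g = tgt G h \<Longrightarrow> shift g x \<in> env g"
  by (induction rule: env_induct)
    (auto simp: shift_add shift_zero shift_orbit
      intro: orbit_in_env subrng_zero[OF subrng_env] subrng_add[OF subrng_env])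

lemma shift_shift:
  "g \<in> arrows G \<Longrightarrow> h \<in> arrows G \<Longrightarrow> src G g = tgt G h \<Longrightarrow> shift g (shift h x) = shift (g \<cdot> h) x"
  by (auto simp: shift_def fun_eq_iff assoc)

lemma shift_identity: "e \<in> identities G \<Longrightarrow> x \<in> env e \<Longrightarrow> shift e x = x"
proof
  fix k
  assume e: "e \<in> identities G" and "x \<in> env e"
  then show "shift e x k = x k"
    using env_support[of x e k] tgt_mul_self[of k]
    by (cases "k \<in> arrows G \<and> tgt G k = e") (auto simp: shift_def inv_identity tgt_identity)
qed

lemma shift_inverse:
  assumes "g \<in> arrows G" "x \<in> env (ginv G g)"
  shows "shift (ginv G g) (shift g x) = x"
  using assms shift_shift[of "ginv G g" g x] shift_identity[of "src G g" x]
    env_cong[of "ginv G g" "src G g"] by (simp flip: src_def)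

lemma shift_iso: "g \<in> arrows G \<Longrightarrow> rng_iso (env (ginv G g)) (env g) (shift g)"
  unfolding rng_iso_def rng_hom_def
proof (intro conjI ballI)
  assume g: "g \<in> arrows G"
  have in1: "shift g x \<in> env g" if "x \<in> env (ginv G g)" for x
    using shift_in_env that g by simp
  have in2: "shift (ginv G g) x \<in> env (ginv G g)" if "x \<in> env g" for x
    using shift_in_env that g by simp
  show "shift g ` env (ginv G g) \<subseteq> env g" using in1 by auto
  show "bij_betw (shift g) (env (ginv G g)) (env g)"
    by (rule bij_betw_byWitness[of _ "shift (ginv G g)"])
      (use in1 in2 shift_inverse[of g] shift_inverse[of "ginv G g"] g in auto)
qed (simp_all add: shift_add shift_mult)

definition fibre_part :: "'g \<Rightarrow> ('g \<Rightarrow> 'a) \<Rightarrow> 'g \<Rightarrow> 'a" where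
  "fibre_part e f = (\<lambda>k. if k \<in> arrows G \<and> tgt G k = e then f k else 0)"

text \<open>
  An ambient ring in which every \<open>env e\<close> is an ideal. On the arrows with target \<open>e\<close> its members
  look like members of \<open>env e\<close>, independently for each \<open>e\<close>, as in a direct product.
\<close>

definition env_ring :: "('g \<Rightarrow> 'a) set" where
  "env_ring = {f. \<forall>e\<in>identities G. fibre_part e f \<in> env e}"

lemma fibre_part_diff: "fibre_part e (x - y) = fibre_part e x - fibre_part e y"
  and fibre_part_mult: "fibre_part e (x * y) = fibre_part e x * fibre_part e y"
  and fibre_part_zero: "fibre_part e 0 = 0"
  by (auto simp: fibre_part_def fun_eq_iff)

lemma fibre_part_env:
  "e \<in> identities G \<Longrightarrow> x \<in> env e \<Longrightarrow> fibre_part e x = x"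
  "e \<in> identities G \<Longrightarrow> e' \<noteq> e \<Longrightarrow> x \<in> env e \<Longrightarrow> fibre_part e' x = 0"
  using env_support[of x e] by (auto simp: fibre_part_def fun_eq_iff tgt_identity)

lemma subrng_env_identity: "e \<in> identities G \<Longrightarrow> subrng (env e)"
  by (intro subrng_env identity_closed)

lemma subrng_env_ring: "subrng env_ring"
  unfolding subrng_def env_ring_def
proof (intro conjI ballI CollectI)
  fix e assume e: "e \<in> identities G"
  note sub = subrng_env_identity[OF e]
  show "fibre_part e 0 \<in> env e" unfolding fibre_part_zero by (rule subrng_zero[OF sub])
  fix x y
  assume "x \<in> {f. \<forall>e\<in>identities G. fibre_part e f \<in> env e}"
    and "y \<in> {f. \<forall>e\<in>identities G. fibre_part e f \<in> env e}"
  then have "fibre_part e x \<in> env e" "fibre_part e y \<in> env e" using e by auto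
  then show "fibre_part e (x - y) \<in> env e" "fibre_part e (x * y) \<in> env e"
    unfolding fibre_part_diff fibre_part_mult
    by (blast intro: subrng_diff[OF sub] subrng_mult[OF sub])+
qed

lemma env_ideal:
  assumes e: "e \<in> identities G"
  shows "ideal_of (env e) env_ring"
proof -
  have sub: "x \<in> env_ring" if x: "x \<in> env e" for x
    unfolding env_ring_def
  proof (intro CollectI ballI)
    fix e' assume "e' \<in> identities G"
    then show "fibre_part e' x \<in> env e'"
      using fibre_part_env[OF e] x subrng_zero[OF subrng_env_identity] by (cases "e' = e") auto
  qed
  have mult: "s * x = fibre_part e s * x" "x * s = x * fibre_part e s" if "x \<in> env e" for x s
    using env_support[OF that] tgt_identity[OF e] by (auto simp: fibre_part_def fun_eq_iff)
  have s: "fibre_part e s \<in> env e" if "s \<in> env_ring" for s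
    using that e unfolding env_ring_def by simp
  note S = subrng_env_identity[OF e]
  show ?thesis
    unfolding ideal_of_def
  proof (intro conjI ballI subsetI)
    fix x y assume x: "x \<in> env e"
    show "x \<in> env_ring" using x by (rule sub)
    show "x - y \<in> env e" if "y \<in> env e" using S x that by (rule subrng_diff)
    fix s assume "s \<in> env_ring"
    then show "s * x \<in> env e" "x * s \<in> env e"
      unfolding mult[OF x, of s] using s x subrng_mult[OF S] by simp_all
  qed (rule subrng_zero[OF S])
qed

lemma env_action: "global_action G env_ring env shift"
proof unfold_locales
  have tgt: "env (tgt G g) = env g" if "g \<in> arrows G" for g
    using that by (intro env_cong tgt_tgt)
  show "subrng env_ring" by (rule subrng_env_ring)
  show "ideal_of (env (tgt G g)) env_ring" if "g \<in> arrows G" for g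
    using that by (intro env_ideal tgt_in_identities)
  show "ideal_of (env g) (env (tgt G g))" if "g \<in> arrows G" for g
    using subrng_env[OF that] tgt[OF that] unfolding ideal_of_def subrng_def by simp
  show "rng_iso (env (ginv G g)) (env g) (shift g)" if "g \<in> arrows G" for g
    using that by (rule shift_iso)
  show "shift e x = x" if "e \<in> identities G" "x \<in> env e" for e x
    using that by (rule shift_identity)
  fix g h assume "(g, h) \<in> composable G"
  then have gh: "g \<in> arrows G" "h \<in> arrows G" "src G g = tgt G h" by simp_all
  have "tgt G (ginv G (g \<cdot> h)) = tgt G (ginv G h)" "tgt G (ginv G g) = tgt G h"
    using gh by simp_all
  note E = env_cong[OF this(1)] env_cong[OF this(2)]
  have "shift h x \<in> env h" if "x \<in> env (ginv G h)" for x
    using shift_in_env[OF that gh(2)] gh(2) by simp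
  then show dom: "comp_dom G env shift g h = env (ginv G (g \<cdot> h))"
    unfolding comp_dom_def E by blast
  show "comp_dom G env shift g h \<subseteq> env (ginv G (g \<cdot> h))"
    unfolding dom by (rule order_refl)
  show "shift g (shift h x) = shift (g \<cdot> h) x" for x
    using gh by (rule shift_shift)
  show "shift g (shift h x) = shift (g \<cdot> h) x" for x
    using gh by (rule shift_shift)
qed

lemma orbit_identity_apply:
  assumes "g \<in> arrows G"
  shows "orbit g a (tgt G g) = \<gamma> g a"
  using assms tgt_mul_self by (simp add: orbit_def)

text \<open>
  As \<open>orbit g b\<close> is the translate of \<open>orbit (src G g) b\<close> by \<open>g\<close>, this says that translation
  extends \<open>\<alpha> g\<close>.
\<close>

lemma orbit_tgt_\<alpha>:
  assumes g: "g \<in> arrows G" and b: "b \<in> D (ginv G g)"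
  shows "orbit (tgt G g) (\<alpha> g b) = orbit g b"
proof
  fix k
  have "ginv G k \<cdot> tgt G g = ginv G k" if "k \<in> arrows G" "tgt G k = tgt G g"
    using mul_src[of "ginv G k"] that by (simp del: mul_src)
  then show "orbit (tgt G g) (\<alpha> g b) k = orbit g b k"
    using \<gamma>_\<alpha>[of g "ginv G k" b] g b by (auto simp: orbit_def)
qed

theorem env_globalization: "globalization G D \<alpha> env_ring env shift"
  unfolding globalization_def
proof (intro conjI exI[of _ orbit] ballI)
  show "global_action G env_ring env shift" by (rule env_action)
next
  fix e assume e: "e \<in> identities G"
  note e' = identity_closed[OF e] src_identity[OF e] tgt_identity[OF e]
  show hom: "rng_hom (D e) (env e) (orbit e)"
    using orbit_hom[of e] orbit_in_env[of e e] e' unfolding rng_hom_def by auto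
  show "inj_on (orbit e) (D e)"
    using orbit_identity_apply[of e] \<gamma>_identity[OF e] e' by (metis inj_onI)
  note S = subrng_orbits[OF e'(1), unfolded e'(2)]
  have prod: "orbit e a * x \<in> orbit e ` D e \<and> x * orbit e a \<in> orbit e ` D e"
    if x: "x \<in> env e" and a: "a \<in> D e" for x a
    using x
  proof (induction rule: env_induct)
    case zero
    show ?case using subrng_zero[OF S] by (metis mult_zero_left mult_zero_right)
  next
    case (add x y)
    then show ?case
      unfolding distrib_left distrib_right by (blast intro: subrng_add[OF S])
  next
    case (gen h b)
    then have h: "h \<in> arrows G" "tgt G h = e" using e' by auto
    then have \<gamma>: "\<gamma> (ginv G e \<cdot> h) b \<in> D e"
      using \<gamma>_in_tgt[of "ginv G e \<cdot> h" b] gen e' by simp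
    then show ?case
      using orbit_mult_left[of h e b a] orbit_mult_right[of e h a b] h gen a e'
        subrng_mult[OF subrng_D[of e]] by auto
  qed
  have "orbit e ` D e \<subseteq> env e" using rng_hom_in[OF hom] by auto
  then show "ideal_of (orbit e ` D e) (env e)"
    using S prod unfolding ideal_of_def subrng_def by auto
next
  fix g assume g: "g \<in> arrows G"
  have translate_all: "shift h (orbit (src G h) b) = orbit h b" if "h \<in> arrows G" for h b
    using shift_orbit[of h "src G h"] that by simp
  note translate = translate_all[OF g]
  show "\<And>a. a \<in> D (ginv G g) \<Longrightarrow> shift g (orbit (src G g) a) = orbit (tgt G g) (\<alpha> g a)"
    using translate orbit_tgt_\<alpha> g by simp
  show "orbit (tgt G g) ` D g = orbit (tgt G g) ` D (tgt G g) \<inter> shift g ` orbit (src G g) ` D (src G g)"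
  proof (intro equalityI subsetI)
    fix x assume "x \<in> orbit (tgt G g) ` D g"
    then obtain a where a: "a \<in> D g" "x = orbit (tgt G g) a" by auto
    let ?b = "\<alpha> (ginv G g) a"
    have b: "?b \<in> D (ginv G g)" "\<alpha> g ?b = a" using a g \<alpha>_in[of "ginv G g"] \<alpha>_inv_right by simp_all
    have "x = shift g (orbit (src G g) ?b)"
      using orbit_tgt_\<alpha>[OF g b(1)] b(2) a(2) translate by simp
    moreover have "?b \<in> D (src G g)" "a \<in> D (tgt G g)"
      using D_subset[of "ginv G g"] D_subset[of g] a b g by auto
    ultimately show "x \<in> orbit (tgt G g) ` D (tgt G g) \<inter> shift g ` orbit (src G g) ` D (src G g)"
      using a(2) by blast
  next
    fix x assume "x \<in> orbit (tgt G g) ` D (tgt G g) \<inter> shift g ` orbit (src G g) ` D (src G g)"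
    then obtain a b where a: "a \<in> D (tgt G g)" "x = orbit (tgt G g) a"
      and b: "b \<in> D (src G g)" "x = orbit g b" using translate by auto
    \<comment> \<open>Evaluation at the identity \<open>tgt G g\<close> recovers \<open>a\<close> from its orbit.\<close>
    have "a = x (tgt G g)"
      using orbit_identity_apply[of "tgt G g" a] \<gamma>_identity[of "tgt G g" a] a g by simp
    also have "\<dots> = \<gamma> g b" using orbit_identity_apply[OF g] b(2) by simp
    finally show "x \<in> orbit (tgt G g) ` D g" using \<gamma>_in[OF g b(1)] a(2) by simp
  qed
  show "env g = family_sum {h \<in> arrows G. tgt G h = tgt G g}
      (\<lambda>h. shift h ` orbit (src G h) ` D (src G h))"
    unfolding env_def
    using translate_all by (intro family_sum_cong) (simp add: image_image)
qed

end


section \<open>Globalizations and the enveloping action\<close>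

locale globalized_partial_action =
  partial_action G R D \<alpha> + glob: global_action G T E \<beta>
  for G :: "('g, 'm) pregroupoid_scheme" (structure)
    and R :: "'a::ring set" and D :: "'g \<Rightarrow> 'a set" and \<alpha> :: "'g \<Rightarrow> 'a \<Rightarrow> 'a"
    and T :: "'t::ring set" and E :: "'g \<Rightarrow> 't set" and \<beta> :: "'g \<Rightarrow> 't \<Rightarrow> 't" +
  fixes \<phi> :: "'g \<Rightarrow> 'a \<Rightarrow> 't"
  assumes unital_identity: "e \<in> identities G \<Longrightarrow> unital (D e)"
    and \<phi>_hom: "e \<in> identities G \<Longrightarrow> rng_hom (D e) (E e) (\<phi> e)"
    and \<phi>_inj: "e \<in> identities G \<Longrightarrow> inj_on (\<phi> e) (D e)"
    and \<phi>_ideal: "e \<in> identities G \<Longrightarrow> ideal_of (\<phi> e ` D e) (E e)"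
    and \<phi>_D: "g \<in> arrows G \<Longrightarrow> \<phi> (tgt G g) ` D g =
           \<phi> (tgt G g) ` D (tgt G g) \<inter> \<beta> g ` \<phi> (src G g) ` D (src G g)"
    and \<beta>_\<phi>: "g \<in> arrows G \<Longrightarrow> a \<in> D (ginv G g) \<Longrightarrow> \<beta> g (\<phi> (src G g) a) = \<phi> (tgt G g) (\<alpha> g a)"
    and E_sum: "g \<in> arrows G \<Longrightarrow> E g = family_sum {h \<in> arrows G. tgt G h = tgt G g}
           (\<lambda>h. \<beta> h ` \<phi> (src G h) ` D (src G h))"
begin

lemma E_cong: "g \<in> arrows G \<Longrightarrow> h \<in> arrows G \<Longrightarrow> tgt G g = tgt G h \<Longrightarrow> E g = E h"
  using E_sum[of g] E_sum[of h] by metis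

lemma E_tgt: "g \<in> arrows G \<Longrightarrow> E (tgt G g) = E g"
  and E_inv: "g \<in> arrows G \<Longrightarrow> E (ginv G g) = E (src G g)"
  by (rule E_cong; simp)+

lemma subrng_E: "e \<in> identities G \<Longrightarrow> subrng (E e)"
  using glob.subrng_D identity_closed by blast

lemma \<beta>_hom: "g \<in> arrows G \<Longrightarrow> rng_hom (E (src G g)) (E (tgt G g)) (\<beta> g)"
  using glob.\<alpha>_hom by (simp add: E_tgt E_inv)

lemma \<beta>_onto: "g \<in> arrows G \<Longrightarrow> \<beta> g ` E (src G g) = E (tgt G g)"
  using glob.iso[of g] unfolding rng_iso_def bij_betw_def by (simp add: E_tgt E_inv)

lemma \<beta>_in: "g \<in> arrows G \<Longrightarrow> x \<in> E (src G g) \<Longrightarrow> \<beta> g x \<in> E (tgt G g)"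
  using rng_hom_in[OF \<beta>_hom] .

lemma \<beta>_\<beta>:
  assumes "g \<in> arrows G" "h \<in> arrows G" "src G g = tgt G h" "x \<in> E (src G h)"
  shows "\<beta> g (\<beta> h x) = \<beta> (g \<cdot> h) x"
  using glob.global_mul[of g h x] assms E_inv[of "g \<cdot> h"] by simp

lemma \<beta>_inv_right: "g \<in> arrows G \<Longrightarrow> x \<in> E (tgt G g) \<Longrightarrow> \<beta> g (\<beta> (ginv G g) x) = x"
  using glob.\<alpha>_inv_right[of g x] by (simp add: E_tgt)

lemma \<phi>_in: "e \<in> identities G \<Longrightarrow> a \<in> D e \<Longrightarrow> \<phi> e a \<in> E e"
  using rng_hom_in[OF \<phi>_hom] .

lemma translate_ideal:
  assumes g: "g \<in> arrows G"
  shows "ideal_of (\<beta> g ` \<phi> (src G g) ` D (src G g)) (E (tgt G g))"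
  using g by (intro ideal_of_image[OF \<beta>_hom \<beta>_onto subrng_E \<phi>_ideal]) simp_all

lemma translate_unital:
  assumes g: "g \<in> arrows G"
  shows "unital (\<beta> g ` \<phi> (src G g) ` D (src G g))"
  using g \<phi>_in
  by (intro unital_image[OF \<beta>_hom] unital_image[OF \<phi>_hom] unital_identity) auto

text \<open>
  The image of \<open>D g\<close> is an intersection of two ideals, a copy of \<open>D (tgt G g)\<close> and a translate of
  \<open>D (src G g)\<close>, and both have an identity.
\<close>

lemma unital_D:
  assumes g: "g \<in> arrows G"
  shows "unital (D g)"
proof (rule unital_image_inj[OF \<phi>_hom[of "tgt G g"] \<phi>_inj])
  have "unital (\<phi> (tgt G g) ` D (tgt G g))"
    using g by (intro unital_image[OF \<phi>_hom] unital_identity) auto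
  then show "unital (\<phi> (tgt G g) ` D g)"
    unfolding \<phi>_D[OF g] using g
    by (intro unital_Int[OF \<phi>_ideal _ translate_ideal translate_unital]) auto
  show "D g \<subseteq> D (tgt G g)" using D_subset g by blast
qed (use g in \<open>simp_all add: subrng_D\<close>)

sublocale unital_partial_action G R D \<alpha>
  by unfold_locales (rule unital_D)

lemma \<alpha>_\<epsilon>: "g \<in> arrows G \<Longrightarrow> \<alpha> g (\<epsilon> (ginv G g)) = \<epsilon> g"
  using \<alpha>_\<epsilon>_mult[of g "ginv G g"] \<epsilon>_right[of "ginv G g" "\<epsilon> (ginv G g)"] \<epsilon>_in[of "ginv G g"]
    \<epsilon>_right[of "tgt G g" "\<epsilon> g"] \<epsilon>_in[of g] D_subset[of g "tgt G g"]
  by (simp flip: tgt_def)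

lemma \<phi>_one: "e \<in> identities G \<Longrightarrow> a \<in> D e \<Longrightarrow> \<phi> e (\<epsilon> e) * \<phi> e a = \<phi> e a \<and> \<phi> e a * \<phi> e (\<epsilon> e) = \<phi> e a"
  using rng_hom_mult[OF \<phi>_hom, symmetric, of e] \<epsilon>_in \<epsilon>_left \<epsilon>_right identity_closed by simp

text \<open>Multiplication by the identity of the ideal \<open>\<phi> e ` D e\<close> is a retraction of \<open>E e\<close> onto it.\<close>

definition proj :: "'g \<Rightarrow> 't \<Rightarrow> 'a" where
  "proj e x = inv_into (D e) (\<phi> e) (x * \<phi> e (\<epsilon> e))"

lemma proj:
  assumes e: "e \<in> identities G" and x: "x \<in> E e"
  shows proj_in: "proj e x \<in> D e" and \<phi>_proj: "\<phi> e (proj e x) = x * \<phi> e (\<epsilon> e)"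
proof -
  have "x * \<phi> e (\<epsilon> e) \<in> \<phi> e ` D e"
    using ideal_mult_left[OF \<phi>_ideal[OF e] x] \<epsilon>_in[OF identity_closed[OF e]] by blast
  then show "proj e x \<in> D e" "\<phi> e (proj e x) = x * \<phi> e (\<epsilon> e)"
    unfolding proj_def by (rule inv_into_into, rule f_inv_into_f)
qed

lemma proj_eqI:
  "e \<in> identities G \<Longrightarrow> a \<in> D e \<Longrightarrow> \<phi> e a = x * \<phi> e (\<epsilon> e) \<Longrightarrow> proj e x = a"
  unfolding proj_def using \<phi>_inj[of e] by (metis inv_into_f_f)

lemma proj_hom: "e \<in> identities G \<Longrightarrow> rng_hom (E e) (D e) (proj e)"
  unfolding rng_hom_def
proof (intro conjI ballI)
  assume e: "e \<in> identities G"
  show "proj e ` E e \<subseteq> D e" using proj_in[OF e] by blast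
  fix x y assume x: "x \<in> E e" and y: "y \<in> E e"
  note sub = subrng_D[OF identity_closed[OF e]]
  show "proj e (x + y) = proj e x + proj e y"
    using proj_in[OF e] x y rng_hom_add[OF \<phi>_hom[OF e]] \<phi>_proj[OF e]
    by (intro proj_eqI[OF e] subrng_add[OF sub]) (simp_all add: distrib_right)
  have "\<phi> e (\<epsilon> e) * \<phi> e (proj e y) = \<phi> e (proj e y)" using \<phi>_one[OF e proj_in[OF e y]] by simp
  then have "\<phi> e (proj e x) * \<phi> e (proj e y) = x * y * \<phi> e (\<epsilon> e)"
    using \<phi>_proj[OF e] x y by (simp add: mult.assoc)
  then show "proj e (x * y) = proj e x * proj e y"
    using proj_in[OF e] x y rng_hom_mult[OF \<phi>_hom[OF e]]
    by (intro proj_eqI[OF e] subrng_mult[OF sub]) simp_all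
qed

text \<open>
  Every globalization induces the same extended maps \<open>\<gamma>\<close>: the product
  \<open>\<beta> g (\<phi> (src G g) a) * \<phi> (tgt G g) (\<epsilon> (tgt G g))\<close> lies in both ideals of the intersection
  condition, hence in the image of \<open>D g\<close>, and there it can be multiplied by the image of
  \<open>\<epsilon> g\<close>, which is the translate of the image of \<open>\<epsilon> (ginv G g)\<close>.
\<close>

lemma proj_translate:
  assumes g: "g \<in> arrows G" and a: "a \<in> D (src G g)"
  shows "proj (tgt G g) (\<beta> g (\<phi> (src G g) a)) = \<gamma> g a"
proof -
  let ?d = "src G g" and ?r = "tgt G g"
  have r: "?r \<in> identities G" "?r \<in> arrows G" and d: "?d \<in> identities G" using g by simp_all
  let ?x = "\<beta> g (\<phi> ?d a)"
  have xE: "?x \<in> E ?r" using \<beta>_in[OF g] \<phi>_in[OF d a] by simp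
  have one: "\<epsilon> ?r \<in> D ?r" using \<epsilon>_in r by simp
  have oneg: "\<epsilon> g \<in> D g" "\<epsilon> g \<in> D ?r" using \<epsilon>_in D_subset[of g] g by auto
  have onei: "\<epsilon> (ginv G g) \<in> D (ginv G g)" "\<epsilon> (ginv G g) \<in> D ?d"
    using \<epsilon>_in[of "ginv G g"] D_subset[of "ginv G g"] g by auto
  have "?x * \<phi> ?r (\<epsilon> ?r) \<in> \<phi> ?r ` D ?r"
    using ideal_mult_left[OF \<phi>_ideal[OF r(1)] xE] one by blast
  moreover have "?x * \<phi> ?r (\<epsilon> ?r) \<in> \<beta> g ` \<phi> ?d ` D ?d"
    using ideal_mult_right[OF translate_ideal[OF g] _ \<phi>_in[OF r(1) one]] a by blast
  ultimately have "?x * \<phi> ?r (\<epsilon> ?r) \<in> \<phi> ?r ` D g"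
    unfolding \<phi>_D[OF g] by blast
  then obtain c where c: "c \<in> D g" "?x * \<phi> ?r (\<epsilon> ?r) = \<phi> ?r c" by auto
  have "c \<in> D ?r" using c D_subset g by blast
  then have "\<phi> ?r c = \<phi> ?r c * \<phi> ?r (\<epsilon> g)"
    using rng_hom_mult[OF \<phi>_hom[OF r(1)] _ oneg(2), symmetric] \<epsilon>_right[OF g c(1)] by simp
  also have "\<dots> = ?x * \<phi> ?r (\<epsilon> g)"
    using \<phi>_one[OF r(1) oneg(2)] by (simp add: c(2)[symmetric] mult.assoc)
  also have "\<phi> ?r (\<epsilon> g) = \<beta> g (\<phi> ?d (\<epsilon> (ginv G g)))"
    using \<beta>_\<phi>[OF g onei(1)] \<alpha>_\<epsilon>[OF g] by simp
  also have "?x * \<dots> = \<beta> g (\<phi> ?d (a * \<epsilon> (ginv G g)))"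
    using rng_hom_mult[OF \<beta>_hom[OF g] \<phi>_in[OF d a] \<phi>_in[OF d onei(2)]]
      rng_hom_mult[OF \<phi>_hom[OF d] a onei(2)] by simp
  also have "\<dots> = \<phi> ?r (\<gamma> g a)"
    unfolding \<gamma>_def using mult_\<epsilon>_inv_in[OF g a] by (rule \<beta>_\<phi>[OF g])
  finally show ?thesis
    using c(2) \<gamma>_in_tgt[OF g a] r by (intro proj_eqI) auto
qed

text \<open>
  The isomorphism onto the action on orbits: it records the projections of all translates of \<open>x\<close>.
\<close>

definition trace :: "'g \<Rightarrow> 't \<Rightarrow> 'g \<Rightarrow> 'a" where
  "trace e x = (\<lambda>k. if k \<in> arrows G \<and> tgt G k = e then proj (src G k) (\<beta> (ginv G k) x) else 0)"

lemma trace_hom: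
  assumes e: "e \<in> identities G"
  shows "rng_hom (E e) UNIV (trace e)"
proof -
  have *: "proj (src G k) (\<beta> (ginv G k) (x + y)) =
       proj (src G k) (\<beta> (ginv G k) x) + proj (src G k) (\<beta> (ginv G k) y)"
    "proj (src G k) (\<beta> (ginv G k) (x * y)) =
       proj (src G k) (\<beta> (ginv G k) x) * proj (src G k) (\<beta> (ginv G k) y)"
    if "x \<in> E e" "y \<in> E e" "k \<in> arrows G" "tgt G k = e" for x y k
    using that rng_hom_add[OF \<beta>_hom[of "ginv G k"]] rng_hom_mult[OF \<beta>_hom[of "ginv G k"]]
      rng_hom_add[OF proj_hom[of "src G k"]] rng_hom_mult[OF proj_hom[of "src G k"]]
      \<beta>_in[of "ginv G k"] by simp_all
  show ?thesis
    unfolding rng_hom_def by (auto simp: trace_def fun_eq_iff *)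
qed

lemma trace_translate:
  assumes h: "h \<in> arrows G" "tgt G h = e" and a: "a \<in> D (src G h)"
  shows "trace e (\<beta> h (\<phi> (src G h) a)) = orbit h a"
proof
  fix k
  show "trace e (\<beta> h (\<phi> (src G h) a)) k = orbit h a k"
    using \<beta>_\<beta>[of "ginv G k" h "\<phi> (src G h) a"] proj_translate[of "ginv G k \<cdot> h" a] \<phi>_in[OF _ a] h a
    by (auto simp: trace_def orbit_def)
qed

lemma E_identity:
  assumes e: "e \<in> identities G"
  shows "E e = family_sum {h \<in> arrows G. tgt G h = e} (\<lambda>h. \<beta> h ` \<phi> (src G h) ` D (src G h))"
  using E_sum[OF identity_closed[OF e]] tgt_identity[OF e] by simp

lemma trace_image:
  assumes e: "e \<in> identities G"
  shows "trace e ` E e = env e"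
proof -
  have "trace e ` E e = family_sum {h \<in> arrows G. tgt G h = e}
      (\<lambda>h. trace e ` \<beta> h ` \<phi> (src G h) ` D (src G h))"
    unfolding arg_cong[OF E_identity[OF e], of "image (trace e)"]
    by (rule family_sum_image[OF trace_hom[OF e] subrng_E[OF e]])
      (use ideal_subset[OF translate_ideal] in blast)
  also have "\<dots> = env e"
    unfolding env_def tgt_identity[OF e]
    by (intro family_sum_cong) (force simp: image_image trace_translate)
  finally show ?thesis .
qed

text \<open>
  An element of trace zero annihilates every translate of every \<open>\<phi> (src G h) ` D (src G h)\<close>,
  and a sum of unital ideals contains no such element except zero.
\<close>

lemma trace_zero:
  assumes e: "e \<in> identities G" and x: "x \<in> E e" and zero: "trace e x = 0"
  shows "x = 0"
proof (rule family_sum_annihilator[OF subrng_E[OF e], of "{h \<in> arrows G. tgt G h = e}"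
      "\<lambda>h. \<beta> h ` \<phi> (src G h) ` D (src G h)"])
  show "x \<in> family_sum {h \<in> arrows G. tgt G h = e} (\<lambda>h. \<beta> h ` \<phi> (src G h) ` D (src G h))"
    using x E_identity[OF e] by simp
  show "ideal_of (\<beta> h ` \<phi> (src G h) ` D (src G h)) (E e)" if "h \<in> {h \<in> arrows G. tgt G h = e}" for h
    using translate_ideal that by auto
  show "unital (\<beta> h ` \<phi> (src G h) ` D (src G h))" if "h \<in> {h \<in> arrows G. tgt G h = e}" for h
    using translate_unital that by auto
  fix h b assume "h \<in> {h \<in> arrows G. tgt G h = e}" and "b \<in> \<beta> h ` \<phi> (src G h) ` D (src G h)"
  then obtain a where h: "h \<in> arrows G" "tgt G h = e" and a: "a \<in> D (src G h)"
    and b: "b = \<beta> h (\<phi> (src G h) a)" by auto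
  let ?d = "src G h" and ?y = "\<beta> (ginv G h) x"
  have d: "?d \<in> identities G" using h by simp
  have y: "?y \<in> E ?d" and xy: "x = \<beta> h ?y"
    using \<beta>_in[of "ginv G h" x] \<beta>_inv_right[of h x] h x by simp_all
  have "proj ?d ?y = trace e x h" using h by (simp add: trace_def)
  then have "proj ?d ?y = 0" using zero by simp
  then have "?y * \<phi> ?d (\<epsilon> ?d) = 0"
    using \<phi>_proj[OF d y] rng_hom_zero[OF \<phi>_hom[OF d] subrng_D[OF identity_closed[OF d]]] by simp
  then have "?y * \<phi> ?d a = 0"
    using \<phi>_one[OF d a] by (metis mult.assoc mult_zero_left)
  moreover have "x * b = \<beta> h (?y * \<phi> ?d a)"
    using rng_hom_mult[OF \<beta>_hom[OF h(1)] y \<phi>_in[OF d a]] b xy by simp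
  ultimately show "x * b = 0"
    using rng_hom_zero[OF \<beta>_hom[OF h(1)] subrng_E[OF d]] by simp
qed

lemma trace_inj:
  assumes e: "e \<in> identities G"
  shows "inj_on (trace e) (E e)"
proof (rule inj_onI)
  fix x y assume x: "x \<in> E e" and y: "y \<in> E e" and eq: "trace e x = trace e y"
  have "trace e (x - y) = trace e x - trace e y"
    using rng_hom_diff[OF trace_hom[OF e] subrng_E[OF e] x y] .
  also have "\<dots> = 0" unfolding eq by (rule diff_self)
  finally have "x - y = 0" by (rule trace_zero[OF e subrng_diff[OF subrng_E[OF e] x y]])
  then show "x = y" by simp
qed

lemma trace_\<beta>:
  assumes g: "g \<in> arrows G" and x: "x \<in> E (src G g)"
  shows "trace (tgt G g) (\<beta> g x) = shift g (trace (src G g) x)"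
proof
  fix k
  show "trace (tgt G g) (\<beta> g x) k = shift g (trace (src G g) x) k"
    using \<beta>_\<beta>[of "ginv G k" g x] g x by (auto simp: trace_def shift_def)
qed

theorem equivalent_env: "equivalent_actions G env shift E \<beta>"
  unfolding equivalent_actions_def
proof (intro exI[of _ trace] conjI ballI)
  fix e assume e: "e \<in> identities G"
  have "rng_hom (E e) (env e) (trace e)"
    using trace_hom[OF e] equalityD1[OF trace_image[OF e]] unfolding rng_hom_def by simp
  then show "rng_iso (E e) (env e) (trace e)"
    unfolding rng_iso_def bij_betw_def using trace_inj[OF e] trace_image[OF e] by simp
next
  fix g x assume "g \<in> arrows G" "x \<in> E (src G g)"
  then show "shift g (trace (src G g) x) = trace (tgt G g) (\<beta> g x)"
    by (rule trace_\<beta>[symmetric])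
qed

end

lemma globalizationE:
  assumes "globalization G D \<alpha> T E \<beta>" and "partial_action G R D \<alpha>"
    and "\<forall>e\<in>identities G. unital (D e)"
  obtains \<phi> where "globalized_partial_action G R D \<alpha> T E \<beta> \<phi>"
proof -
  have G: "global_action G T E \<beta>" using assms(1) unfolding globalization_def by (rule conjunct1)
  obtain \<phi> where \<phi>:
    "\<forall>e\<in>identities G. rng_hom (D e) (E e) (\<phi> e) \<and> inj_on (\<phi> e) (D e)"
    "\<forall>e\<in>identities G. ideal_of (\<phi> e ` D e) (E e)"
    "\<forall>g\<in>arrows G. \<phi> (tgt G g) ` D g =
       \<phi> (tgt G g) ` D (tgt G g) \<inter> \<beta> g ` \<phi> (src G g) ` D (src G g)"
    "\<forall>g\<in>arrows G. \<forall>a\<in>D (ginv G g). \<beta> g (\<phi> (src G g) a) = \<phi> (tgt G g) (\<alpha> g a)"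
    "\<forall>g\<in>arrows G. E g = family_sum {h \<in> arrows G. tgt G h = tgt G g}
       (\<lambda>h. \<beta> h ` \<phi> (src G h) ` D (src G h))"
    using assms(1) unfolding globalization_def by (elim conjE exE) (rule that)
  show ?thesis
  proof (rule that, rule globalized_partial_action.intro[OF assms(2) G], unfold_locales)
    show "rng_hom (D e) (E e) (\<phi> e)" "inj_on (\<phi> e) (D e)" if "e \<in> identities G" for e
      using \<phi>(1) that by blast+
  qed ((use assms(3) \<phi>(2) in blast)+, (rule \<phi>(3-5)[rule_format]; assumption)+)
qed


section \<open>Equivalence of actions\<close>

lemma rng_iso_comp: "rng_iso A B f \<Longrightarrow> rng_iso B C g \<Longrightarrow> rng_iso A C (g \<circ> f)"
  unfolding rng_iso_def rng_hom_def by (auto intro: bij_betw_trans simp: image_subset_iff)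

lemma rng_iso_inv:
  assumes f: "rng_iso A B f" and A: "subrng A"
  shows "rng_iso B A (inv_into A f)"
  unfolding rng_iso_def rng_hom_def
proof (intro conjI ballI)
  have hom: "rng_hom A B f" and bij: "bij_betw f A B" using f unfolding rng_iso_def by auto
  show bij': "bij_betw (inv_into A f) B A" using bij by (rule bij_betw_inv_into)
  then show "inv_into A f ` B \<subseteq> A" unfolding bij_betw_def by simp
  fix x y assume x: "x \<in> B" and y: "y \<in> B"
  let ?x = "inv_into A f x" and ?y = "inv_into A f y"
  have in_A: "?x \<in> A" "?y \<in> A" using x y bij' bij_betwE by blast+
  have "f ?x = x" "f ?y = y" using x y bij_betw_inv_into_right[OF bij] by auto
  then have "f (?x + ?y) = x + y" "f (?x * ?y) = x * y"
    using rng_hom_add[OF hom in_A] rng_hom_mult[OF hom in_A] by auto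
  then show "inv_into A f (x + y) = ?x + ?y" "inv_into A f (x * y) = ?x * ?y"
    using bij_betw_inv_into_left[OF bij subrng_add[OF A in_A]]
      bij_betw_inv_into_left[OF bij subrng_mult[OF A in_A]] by auto
qed

text \<open>
  The two comparison maps have the action \<open>F\<close> as common target, so the first is inverted; its
  injectivity transports equivariance back from \<open>F\<close>.
\<close>

lemma equivalent_actions_via:
  assumes G: "groupoid G"
    and E: "equivalent_actions G F s E \<beta>" "\<And>e. e \<in> identities G \<Longrightarrow> subrng (E e)"
      "\<And>g x. g \<in> arrows G \<Longrightarrow> x \<in> E (src G g) \<Longrightarrow> \<beta> g x \<in> E (tgt G g)"
    and E': "equivalent_actions G F s E' \<beta>'"
      "\<And>g x. g \<in> arrows G \<Longrightarrow> x \<in> E' (src G g) \<Longrightarrow> \<beta>' g x \<in> E' (tgt G g)"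
  shows "equivalent_actions G E \<beta> E' \<beta>'"
proof -
  obtain \<chi> where \<chi>: "\<forall>e\<in>identities G. rng_iso (E e) (F e) (\<chi> e)"
    and \<chi>_eq: "\<forall>g\<in>arrows G. \<forall>a\<in>E (src G g). s g (\<chi> (src G g) a) = \<chi> (tgt G g) (\<beta> g a)"
    using E(1) unfolding equivalent_actions_def by auto
  obtain \<chi>' where \<chi>': "\<forall>e\<in>identities G. rng_iso (E' e) (F e) (\<chi>' e)"
    and \<chi>'_eq: "\<forall>g\<in>arrows G. \<forall>a\<in>E' (src G g). s g (\<chi>' (src G g) a) = \<chi>' (tgt G g) (\<beta>' g a)"
    using E'(1) unfolding equivalent_actions_def by auto
  define \<psi> where "\<psi> e = inv_into (E e) (\<chi> e) \<circ> \<chi>' e" for e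
  have iso: "rng_iso (E' e) (E e) (\<psi> e)" if "e \<in> identities G" for e
    unfolding \<psi>_def using rng_iso_comp[of "E' e" "F e" "\<chi>' e"] rng_iso_inv[of "E e" "F e"] \<chi> \<chi>' E(2) that
    by blast
  have inv: "\<chi> e (\<psi> e a) = \<chi>' e a" if "e \<in> identities G" "a \<in> E' e" for e a
  proof -
    have "\<chi>' e a \<in> F e" using \<chi>' that unfolding rng_iso_def bij_betw_def by blast
    then show ?thesis
      using \<chi> that bij_betw_inv_into_right[of "\<chi> e" "E e" "F e"] unfolding \<psi>_def rng_iso_def by auto
  qed
  have \<psi>_in: "\<psi> e a \<in> E e" if "e \<in> identities G" "a \<in> E' e" for e a
    using iso[OF that(1)] that(2) unfolding rng_iso_def bij_betw_def by blast
  have "\<beta> g (\<psi> (src G g) a) = \<psi> (tgt G g) (\<beta>' g a)"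
    if g: "g \<in> arrows G" and a: "a \<in> E' (src G g)" for g a
  proof (rule inj_onD)
    have d: "src G g \<in> identities G" and r: "tgt G g \<in> identities G"
      using groupoid.src_in_identities[OF G g] groupoid.tgt_in_identities[OF G g] by auto
    show "inj_on (\<chi> (tgt G g)) (E (tgt G g))"
      using \<chi> r unfolding rng_iso_def bij_betw_def by blast
    show "\<beta> g (\<psi> (src G g) a) \<in> E (tgt G g)" using E(3)[OF g] \<psi>_in[OF d a] .
    show "\<psi> (tgt G g) (\<beta>' g a) \<in> E (tgt G g)" using \<psi>_in[OF r E'(2)[OF g a]] .
    show "\<chi> (tgt G g) (\<beta> g (\<psi> (src G g) a)) = \<chi> (tgt G g) (\<psi> (tgt G g) (\<beta>' g a))"
      using \<chi>_eq \<chi>'_eq g a \<psi>_in[OF d a] inv[OF d a] inv[OF r E'(2)[OF g a]] by metis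
  qed
  with iso show ?thesis unfolding equivalent_actions_def by blast
qed

theorem theorem2p1:
  fixes G :: "('g, 'm) pregroupoid_scheme"
    and R :: "'a::ring set" and D :: "'g \<Rightarrow> 'a set" and \<alpha> :: "'g \<Rightarrow> 'a \<Rightarrow> 'a"
  assumes "partial_action G R D \<alpha>"
    and "\<forall>e\<in>identities G. unital (D e)"
  shows "((\<exists>(T :: ('g \<Rightarrow> 'a) set) E \<beta>. globalization G D \<alpha> T E \<beta>) \<longleftrightarrow>
            (\<forall>g\<in>arrows G. unital (D g))) \<and>
         (\<forall>(T :: 't::ring set) E \<beta>. globalization G D \<alpha> T E \<beta> \<longrightarrow>
            (\<forall>g\<in>arrows G. unital (D g))) \<and>
         (\<forall>(T :: 't::ring set) E \<beta> (T' :: 'u::ring set) E' \<beta>'.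
            globalization G D \<alpha> T E \<beta> \<longrightarrow> globalization G D \<alpha> T' E' \<beta>' \<longrightarrow>
            equivalent_actions G E \<beta> E' \<beta>')"
proof (intro conjI iffI allI impI)
  show "\<forall>g\<in>arrows G. unital (D g)"
    if "\<exists>(T :: ('g \<Rightarrow> 'a) set) E \<beta>. globalization G D \<alpha> T E \<beta>"
    using that globalizationE[OF _ assms] globalized_partial_action.unital_D by metis
  show "\<forall>g\<in>arrows G. unital (D g)" if "globalization G D \<alpha> T E \<beta>" for T :: "'t set" and E \<beta>
    using globalizationE[OF that assms] globalized_partial_action.unital_D by metis
  show "\<exists>(T :: ('g \<Rightarrow> 'a) set) E \<beta>. globalization G D \<alpha> T E \<beta>"
    if "\<forall>g\<in>arrows G. unital (D g)"
  proof -
    have "unital_partial_action G R D \<alpha>"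
      using assms(1) that unfolding unital_partial_action_def unital_partial_action_axioms_def by blast
    from unital_partial_action.env_globalization[OF this] show ?thesis by blast
  qed
  fix T :: "'t set" and E \<beta> and T' :: "'u set" and E' \<beta>'
  assume "globalization G D \<alpha> T E \<beta>" and "globalization G D \<alpha> T' E' \<beta>'"
  then obtain \<phi> \<phi>' where "globalized_partial_action G R D \<alpha> T E \<beta> \<phi>"
    and "globalized_partial_action G R D \<alpha> T' E' \<beta>' \<phi>'"
    using globalizationE[OF _ assms] by metis
  then interpret X: globalized_partial_action G R D \<alpha> T E \<beta> \<phi>
    by simp
  interpret Y: globalized_partial_action G R D \<alpha> T' E' \<beta>' \<phi>'
    by fact
  show "equivalent_actions G E \<beta> E' \<beta>'"
    by (rule equivalent_actions_via[OF X.groupoid_axioms X.equivalent_env X.subrng_E X.\<beta>_in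
          Y.equivalent_env Y.\<beta>_in])
qed

end
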